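(* Let $\mathcal H,\widetilde{\mathcal H},\widetilde{\mathcal H}'$ be complex Banach spaces, $d\ge1$, $l\in\{0,\dots,d\}$, and let $P(\lambda)=\sum_{i=0}^d\lambda^iP_i$ with $\mathcal D(P(\lambda))=\mathcal D(P_l)$, where $P_l\in\mathcal L(\mathcal H)$, $P_i\in\mathcal B(\mathcal H)$ for $i\ne l$, and $P_d$ is invertible. Put $\widehat P_i:=P_d^{-1}P_i$ for $i<d$. Let $\Omega':=\mathbb C$ if $l=0$ and $\Omega':=\mathbb C\setminus\{0\}$ otherwise, and let $\Omega\subset\Omega'$. Let $X:\Omega\to\mathcal L(\widetilde{\mathcal H},\mathcal H)$, $Z:\Omega\to\mathcal L(\widetilde{\mathcal H},\widetilde{\mathcal H}')$ and $Q(\lambda)=\sum_{i=0}^{d-1}\lambda^iQ_i$ with $Q_i\in\mathcal L(\mathcal H,\widetilde{\mathcal H}')$, where $Q_i\in\mathcal B(\mathcal H,\widetilde{\mathcal H}')$ for $i\neq l$; if $l=d$ assume in addition $\overline{P_d^{-1}X(\lambda)}\in\mathcal B(\widetilde{\mathcal H},\mathcal H)$ for all $\lambda\in\Omega$. On natural domains define for $\lambda\in\Omega$ $$\mathcal P(\lambda):=\begin{bmatrix} P(\lambda) & X(\lambda) \\ Q(\lambda) & Z(\lambda) \end{bmatrix}\in\mathcal L(\mathcal H\oplus\widetilde{\mathcal H},\mathcal H\oplus\widetilde{\mathcal H}'),$$ $$\mathcal T(\lambda):=\begin{bmatrix} -\widehat P_{d-1}-\lambda & -\widehat P_{d-2}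 & \cdots & -\widehat P_1 & -\widehat P_0 & -P_d^{-1}X(\lambda) \\ I_{\mathcal H} & -\lambda & & & & \\ & I_{\mathcal H} & \ddots & & & \\ & & \ddots & -\lambda & & \\ & & & I_{\mathcal H} & -\lambda & \\ Q_{d-1} & Q_{d-2} & \cdots & Q_1 & Q_0 & Z(\lambda) \end{bmatrix}\in\mathcal L(\mathcal H^d\oplus\widetilde{\mathcal H},\mathcal H^d\oplus\widetilde{\mathcal H}').$$ Let $W(\lambda)\in\mathcal B(\mathcal H^{\max(d-1,l)})$ be $W(\lambda)=I_{\mathcal H^{d-1-l}}\oplus N_l(\lambda)$, where $N_l(\lambda)$ is the $l\times l$ operator matrix with $-\lambda$ on the diagonal and $I_{\mathcal H}$ on the first subdiagonal, and set $$\mathcal P_{\rm ext}(\lambda):=\begin{bmatrix} P(\lambda) & 0 & X(\lambda) \\ 0 & W(\lambda) & 0 \\ Q(\lambda) & 0 & Z(\lambda) \end{bmatrix}$$ (which is $\mathcal P(\lambda)\oplus W(\lambda)$ up to reordering of the spaces). Then: (i) if $l<d$, $\mathcal P_{\rm ext}$ is equivalent to $\mathcal T$ on $\Omega$; (ii) if $l=d$, $\mathcal P_{\rm ext}$ is equivalent to $P_d\oplus\mathcal T$ on $\Omega$. In both cases $\mathcal P_{\rm ext}(\lambda)=\mathcal E(\lambda)\,\mathcal T_*(\lambda)\,\mathcal F(\lambda)$ and $\mathcal D(\mathcal P_{\rm ext}(\lambda))=\mathcal F(\lambda)^{-1}\mathcal D(\mathcal T_*(\lambda))$, with $\mathcal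 T_*=\mathcal T$ if $l<d$, $\mathcal T_*=P_d\oplus\mathcal T$ if $l=d$, and $$\mathcal E(\lambda)=\begin{bmatrix} E(\lambda) & 0 \\ \widetilde E(\lambda) & I_{\widetilde{\mathcal H}'} \end{bmatrix},\qquad\mathcal F(\lambda)=\begin{bmatrix} F(\lambda) & \widetilde F(\lambda) \\ 0 & I_{\widetilde{\mathcal H}} \end{bmatrix},$$ where $E,F$ are the operator matrix functions written out in the context, and $\widetilde E,\widetilde F$ are as follows. For $l<d$ let $\widetilde E_\alpha(\lambda):\mathcal H^{d-l}\to\widetilde{\mathcal H}'$ be the row $$\widetilde E_\alpha(\lambda)=\begin{bmatrix} 0 & -Q_{d-1} & -\sum_{k=0}^1\lambda^kQ_{d-2+k} & \cdots & -\sum_{k=0}^{d-l-2}\lambda^kQ_{l+1+k} \end{bmatrix}$$ ($\widetilde E_\alpha=0$ if $l=d-1$), and for $l>0$ let $\widetilde E_\beta(\lambda):\mathcal H^l\to\widetilde{\mathcal H}'$ be $$\widetilde E_\beta(\lambda)=\begin{bmatrix} \sum_{k=0}^{l-1}\frac{Q_k}{\lambda^{l-k}} & \cdots & \sum_{k=0}^1\frac{Q_k}{\lambda^{2-k}} & \frac{Q_0}{\lambda} \end{bmatrix}.$$ Then $\widetilde E=\widetilde E_\alpha$, $\widetilde F=0$ if $l=0$; $\widetilde E=[\widetilde E_\alpha\ \ \widetilde E_\beta]$, $\widetilde F=0$ if $0<l<d$; and $\widetilde E(\lambda)=\big[\lambda^{-d}Q(\lambda)P_d^{-1}\ \ \widetilde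 E_\beta(\lambda)\big]$, $\widetilde F(\lambda)=\begin{bmatrix} \overline{P_d^{-1}X(\lambda)} \\ 0 \end{bmatrix}$ if $l=d$.
   Context: $\mathcal L(\mathcal X,\mathcal Y)$: linear, not necessarily bounded, operators $A$ with domain $\mathcal D(A)\subset\mathcal X$; $\mathcal B(\mathcal X,\mathcal Y)$: everywhere defined bounded operators. $\overline A$ is the closure of $A$. $\mathcal H^m=\bigoplus_{i=1}^m\mathcal H$, with $\mathcal H^m=\{0\}$ for $m\le0$. Invertible means bijective from the domain onto the target space with bounded inverse. Scalars stand for multiples of the identity. Blank entries are $0$. The natural domain of an operator matrix is the direct sum over the columns of the intersection of the domains of the entries in that column. Equivalence: $S:\Omega_S\to\mathcal L(\mathcal X,\mathcal X')$ and $T:\Omega_T\to\mathcal L(\mathcal Y,\mathcal Y')$ are equivalent on $\Omega\subset\Omega_S\cap\Omega_T$ if there are $E:\Omega\to\mathcal B(\mathcal Y',\mathcal X')$, $F:\Omega\to\mathcal B(\mathcal X,\mathcal Y)$, invertible for each $\lambda\in\Omega$, with $S(\lambda)=E(\lambda)T(\lambda)F(\lambda)$ and $\mathcal D(S(\lambda))=F(\lambda)^{-1}\mathcal D(T(\lambda))$. The functions $E,F$. For $l<d$ let $E_\alpha(\lambda),F_\alpha(\lambda)$ be the $(d-l)\times(d-l)$ operator matrices $$E_\alpha(\lambda)=\begin{bmatrix} -P_d & -\sum_{k=0}^1\lambda^kP_{d-1+k} & \cdots & \cdots & -\sum_{k=0}^{d-l-1}\lambda^kP_{l+1+k} \\ &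 I_{\mathcal H} & \lambda & \cdots & \lambda^{d-l-2} \\ & & \ddots & \ddots & \vdots \\ & & & \ddots & \lambda \\ & & & & I_{\mathcal H} \end{bmatrix},\quad F_\alpha(\lambda)=\begin{bmatrix} \lambda^{d-1} & I_{\mathcal H} & & \\ \vdots & & \ddots & \\ \lambda^{l+1} & & & I_{\mathcal H} \\ \lambda^l & & & \end{bmatrix}$$ ($E_\alpha=-P_d$, $F_\alpha=\lambda^{d-1}$ if $l=d-1$). For $l>0$ let $E_\beta(\lambda):\mathcal H^l\to\mathcal H^{\max(d-l,1)}$ have first row $\big[\sum_{k=0}^{l-1}\frac{P_k}{\lambda^{l-k}}\ \cdots\ \sum_{k=0}^1\frac{P_k}{\lambda^{2-k}}\ \ \frac{P_0}{\lambda}\big]$ and zero remaining rows, and let $F_\beta(\lambda):\mathcal H^{\max(d-l,1)}\to\mathcal H^l$ have first column $(\lambda^{l-1},\dots,\lambda,I_{\mathcal H})^{\top}$ and zero remaining columns. For $l=d$ let $E_\gamma=\begin{bmatrix} P_d^{-1} \\ 0 \end{bmatrix}:\mathcal H\to\mathcal H^d$ and $F_\gamma=[\widehat P_{d-1}\ \cdots\ \widehat P_0]:\mathcal H^d\to\mathcal H$. Then - $l=0$: $E=E_\alpha$, $F=F_\alpha$; - $0<l<d$: $E=\begin{bmatrix} E_\alpha & E_\beta \\ 0 & I_{\mathcal H^l} \end{bmatrix}$, $F=\begin{bmatrix} F_\alpha & 0 \\ F_\beta & I_{\mathcal H^l} \end{bmatrix}$; - $l=d$: $E=\begin{bmatrix}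 \lambda^{-d}P(\lambda)P_d^{-1} & E_\beta \\ E_\gamma & I_{\mathcal H^d} \end{bmatrix}$, $F=\begin{bmatrix} \lambda^d+\sum_{i=0}^{d-1}\lambda^i\widehat P_i & F_\gamma \\ F_\beta & I_{\mathcal H^d} \end{bmatrix}$. *)

theory Defs
  imports "HOL-Analysis.Analysis"
begin

section \<open>Complex Banach spaces\<close>

text \<open>The normed spaces of the library are real; a complex one carries in addition a
  multiplication by complex scalars that extends the real one and is compatible with the norm.\<close>

class complex_normed_vector = real_normed_vector +
  fixes scaleC :: "complex \<Rightarrow> 'a \<Rightarrow> 'a" (infixr \<open>*\<^sub>C\<close> 75)
  assumes scaleC_add_right: "a *\<^sub>C (x + y) = a *\<^sub>C x + a *\<^sub>C y"
    and scaleC_add_left: "(a + b) *\<^sub>C x = a *\<^sub>C x + b *\<^sub>C x"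
    and scaleC_scaleC: "a *\<^sub>C (b *\<^sub>C x) = (a * b) *\<^sub>C x"
    and scaleC_of_real: "complex_of_real r *\<^sub>C x = r *\<^sub>R x"
    and norm_scaleC: "norm (a *\<^sub>C x) = cmod a * norm x"

class complex_banach = complex_normed_vector + banach

instantiation complex :: complex_normed_vector
begin
definition scaleC_complex :: "complex \<Rightarrow> complex \<Rightarrow> complex"
  where "scaleC_complex a x = a * x"
instance
  by standard (auto simp: scaleC_complex_def algebra_simps norm_mult scaleR_conv_of_real)
end

instance complex :: complex_banach ..

instantiation prod :: (complex_normed_vector, complex_normed_vector) complex_normed_vector
begin
definition scaleC_prod :: "complex \<Rightarrow> 'a \<times> 'b \<Rightarrow> 'a \<times> 'b"
  where "scaleC_prod a x = (a *\<^sub>C fst x, a *\<^sub>C snd x)"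
instance
proof
  fix a :: complex and x :: "'a \<times> 'b"
  have "norm (a *\<^sub>C x) = sqrt ((cmod a)\<^sup>2 * ((norm (fst x))\<^sup>2 + (norm (snd x))\<^sup>2))"
    by (simp add: scaleC_prod_def norm_prod_def norm_scaleC power_mult_distrib algebra_simps)
  then show "norm (a *\<^sub>C x) = cmod a * norm x"
    by (simp add: real_sqrt_mult norm_prod_def)
qed (auto simp: scaleC_prod_def scaleC_add_right scaleC_add_left scaleC_scaleC scaleC_of_real
      prod_eq_iff)
end

lemma scaleC_mem_bcontfun:
  fixes f :: "'a::topological_space \<Rightarrow> 'b::complex_normed_vector"
  assumes "f \<in> bcontfun" shows "(\<lambda>x. a *\<^sub>C f x) \<in> bcontfun"
proof -
  have bl: "bounded_linear (\<lambda>x::'b. a *\<^sub>C x)"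
  proof (rule bounded_linear_intro)
    fix r and x :: 'b
    show "a *\<^sub>C (r *\<^sub>R x) = r *\<^sub>R (a *\<^sub>C x)"
      by (simp flip: scaleC_of_real add: scaleC_scaleC mult.commute)
    show "norm (a *\<^sub>C x) \<le> norm x * cmod a"
      by (simp add: norm_scaleC mult.commute)
  qed (rule scaleC_add_right)
  from assms have "continuous_on UNIV f" "bounded (range f)" by (auto simp: bcontfun_def)
  then show ?thesis
    using bounded_linear.continuous_on[OF bl] bounded_linear_image[OF _ bl, of "range f"]
    by (simp add: bcontfun_def image_image)
qed

instantiation bcontfun :: (topological_space, complex_normed_vector) complex_normed_vector
begin
definition scaleC_bcontfun :: "complex \<Rightarrow> ('a \<Rightarrow>\<^sub>C 'b) \<Rightarrow> 'a \<Rightarrow>\<^sub>C 'b"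
  where "scaleC_bcontfun a f = Bcontfun (\<lambda>x. a *\<^sub>C apply_bcontfun f x)"
lemma apply_scaleC_bcontfun: "apply_bcontfun (a *\<^sub>C f) x = a *\<^sub>C apply_bcontfun f x"
  for f :: "'a \<Rightarrow>\<^sub>C 'b"
  unfolding scaleC_bcontfun_def
  by (subst Bcontfun_inverse[OF scaleC_mem_bcontfun[OF apply_bcontfun]]) (rule refl)
instance
proof
  fix a :: complex and f :: "'a \<Rightarrow>\<^sub>C 'b"
  have le: "norm (a *\<^sub>C f) \<le> cmod a * norm f" for a and f :: "'a \<Rightarrow>\<^sub>C 'b"
    by (rule norm_bound) (simp add: apply_scaleC_bcontfun norm_scaleC mult_left_mono norm_bounded)
  show "norm (a *\<^sub>C f) = cmod a * norm f"
  proof (cases "a = 0")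
    case True
    then show ?thesis using le[of a f] by simp
  next
    case False
    have one: "1 *\<^sub>C x = x" for x :: 'b
      using scaleC_of_real[of 1 x] by simp
    have "f = inverse a *\<^sub>C (a *\<^sub>C f)"
      using False by (intro bcontfun_eqI) (simp add: apply_scaleC_bcontfun scaleC_scaleC one)
    then have "norm f \<le> inverse (cmod a) * norm (a *\<^sub>C f)"
      using le[of "inverse a" "a *\<^sub>C f"] by (simp add: norm_inverse)
    then have "cmod a * norm f \<le> norm (a *\<^sub>C f)"
      using False by (simp add: field_simps)
    then show ?thesis using le[of a f] by simp
  qed
qed (auto intro!: bcontfun_eqI simp: apply_scaleC_bcontfun scaleC_add_right scaleC_add_left
      scaleC_scaleC scaleC_of_real)
end


section \<open>Linear operators with domain\<close>

text \<open>An operator is a partial function: \<open>dom A\<close> is its domain, equality includes equality of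
  domains, and \<open>A \<circ>\<^sub>m B\<close> is the product on its natural domain.
  The spaces are subspaces \<open>U\<close>, \<open>V\<close> of the ambient types.\<close>

definition lin_ops :: "'a::complex_normed_vector set \<Rightarrow> 'b::complex_normed_vector set \<Rightarrow> ('a \<rightharpoonup> 'b) set"
  where "lin_ops U V = {A. dom A \<subseteq> U \<and> ran A \<subseteq> V \<and> 0 \<in> dom A \<and>
    (\<forall>x\<in>dom A. \<forall>y\<in>dom A. A (x + y) = Some (the (A x) + the (A y))) \<and>
    (\<forall>c. \<forall>x\<in>dom A. A (c *\<^sub>C x) = Some (c *\<^sub>C the (A x)))}"

definition bdd_ops :: "'a::complex_normed_vector set \<Rightarrow> 'b::complex_normed_vector set \<Rightarrow> ('a \<rightharpoonup> 'b) set"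
  where "bdd_ops U V = {A \<in> lin_ops U V. dom A = U \<and>
    (\<exists>K. \<forall>x\<in>U. norm (the (A x)) \<le> K * norm x)}"

definition op_inv :: "('a \<rightharpoonup> 'b) \<Rightarrow> 'b \<rightharpoonup> 'a"
  where "op_inv A y = (if y \<in> ran A then Some (THE x. A x = Some y) else None)"

definition invertible_op :: "'a::complex_normed_vector set \<Rightarrow> 'b::complex_normed_vector set \<Rightarrow> ('a \<rightharpoonup> 'b) \<Rightarrow> bool"
  where "invertible_op U V A \<longleftrightarrow>
    A \<in> lin_ops U V \<and> inj_on A (dom A) \<and> ran A = V \<and> op_inv A \<in> bdd_ops V U"

text \<open>The operator whose graph is the closure of the graph of \<open>A\<close>. If \<open>A\<close> is linear but not
  closable, the closure of the graph has several values over every point of its projection, and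
  \<open>op_closure A\<close> is the empty map, which is not an element of any \<open>lin_ops U V\<close>.\<close>

definition op_closure :: "('a::topological_space \<rightharpoonup> 'b::topological_space) \<Rightarrow> 'a \<rightharpoonup> 'b"
  where "op_closure A x =
    (let G = closure {(u, v). A u = Some v}
     in if \<exists>!y. (x, y) \<in> G then Some (THE y. (x, y) \<in> G) else None)"

definition scalar_op :: "complex \<Rightarrow> 'a::complex_normed_vector \<rightharpoonup> 'a"
  where "scalar_op c x = Some (c *\<^sub>C x)"

definition zero_op :: "'a \<rightharpoonup> 'b::zero"
  where "zero_op x = Some 0"

text \<open>Multiplication by a scalar, even by zero, keeps the domain.\<close>

definition op_scale :: "complex \<Rightarrow> ('a \<rightharpoonup> 'b::complex_normed_vector) \<Rightarrow> 'a \<rightharpoonup> 'b" (infixr \<open>*\<^sub>o\<close> 75)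
  where "(c *\<^sub>o A) x = map_option (\<lambda>y. c *\<^sub>C y) (A x)"

definition op_plus :: "('a \<rightharpoonup> 'b::plus) \<Rightarrow> ('a \<rightharpoonup> 'b) \<Rightarrow> 'a \<rightharpoonup> 'b" (infixl \<open>+\<^sub>o\<close> 65)
  where "(A +\<^sub>o B) x = (case (A x, B x) of (Some a, Some b) \<Rightarrow> Some (a + b) | _ \<Rightarrow> None)"

definition op_sum :: "('i \<Rightarrow> 'a \<rightharpoonup> 'b::comm_monoid_add) \<Rightarrow> 'i set \<Rightarrow> 'a \<rightharpoonup> 'b"
  where "op_sum A I x = (if \<forall>i\<in>I. x \<in> dom (A i) then Some (\<Sum>i\<in>I. the (A i x)) else None)"

definition op_poly :: "nat set \<Rightarrow> (nat \<Rightarrow> 'a \<rightharpoonup> 'b::complex_normed_vector) \<Rightarrow> complex \<Rightarrow> 'a \<rightharpoonup> 'b"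
  where "op_poly I P \<mu> = op_sum (\<lambda>i. \<mu> ^ i *\<^sub>o P i) I"

definition op_dsum :: "('a \<rightharpoonup> 'b) \<Rightarrow> ('c \<rightharpoonup> 'd) \<Rightarrow> 'a \<times> 'c \<rightharpoonup> 'b \<times> 'd"
  where "op_dsum A B = (\<lambda>(x, y). case (A x, B y) of (Some a, Some b) \<Rightarrow> Some (a, b) | _ \<Rightarrow> None)"


section \<open>Equivalence of operator functions\<close>

definition equivalent_via ::
  "complex set \<Rightarrow> 'a::complex_normed_vector set \<Rightarrow> 'b::complex_normed_vector set
    \<Rightarrow> 'c::complex_normed_vector set \<Rightarrow> 'd::complex_normed_vector set
    \<Rightarrow> (complex \<Rightarrow> 'a \<rightharpoonup> 'b) \<Rightarrow> (complex \<Rightarrow> 'c \<rightharpoonup> 'd)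
    \<Rightarrow> (complex \<Rightarrow> 'd \<rightharpoonup> 'b) \<Rightarrow> (complex \<Rightarrow> 'a \<rightharpoonup> 'c) \<Rightarrow> bool"
  where "equivalent_via \<Omega> U U' V V' S T E F \<longleftrightarrow>
    (\<forall>\<mu>\<in>\<Omega>. S \<mu> \<in> lin_ops U U' \<and> T \<mu> \<in> lin_ops V V' \<and>
      E \<mu> \<in> bdd_ops V' U' \<and> invertible_op V' U' (E \<mu>) \<and>
      F \<mu> \<in> bdd_ops U V \<and> invertible_op U V (F \<mu>) \<and>
      S \<mu> = E \<mu> \<circ>\<^sub>m T \<mu> \<circ>\<^sub>m F \<mu> \<and>
      dom (S \<mu>) = {x. \<exists>y\<in>dom (T \<mu>). F \<mu> x = Some y})"

definition equivalent_on ::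
  "complex set \<Rightarrow> 'a::complex_normed_vector set \<Rightarrow> 'b::complex_normed_vector set
    \<Rightarrow> 'c::complex_normed_vector set \<Rightarrow> 'd::complex_normed_vector set
    \<Rightarrow> (complex \<Rightarrow> 'a \<rightharpoonup> 'b) \<Rightarrow> (complex \<Rightarrow> 'c \<rightharpoonup> 'd) \<Rightarrow> bool"
  where "equivalent_on \<Omega> U U' V V' S T \<longleftrightarrow> (\<exists>E F. equivalent_via \<Omega> U U' V V' S T E F)"


section \<open>Powers of a space and operator matrices\<close>

text \<open>The \<open>m\<close>-th power of \<open>'h\<close> consists of the sequences supported on \<open>{..<m}\<close>, inside the space of
  bounded sequences (every function on \<open>nat\<close> is continuous). Its norm is the maximum norm.
  Components are numbered from 0.\<close>

type_synonym 'h seq = "nat \<Rightarrow>\<^sub>C 'h"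

definition power_space :: "nat \<Rightarrow> 'h::complex_normed_vector seq set"
  where "power_space m = {x. \<forall>i\<ge>m. apply_bcontfun x i = 0}"

definition seq_of :: "nat \<Rightarrow> (nat \<Rightarrow> 'h::complex_normed_vector) \<Rightarrow> 'h seq"
  where "seq_of m f = Bcontfun (\<lambda>i. if i < m then f i else 0)"

definition seq_tl :: "'h::complex_normed_vector seq \<Rightarrow> 'h seq"
  where "seq_tl x = Bcontfun (\<lambda>i. apply_bcontfun x (Suc i))"

definition seq_cons :: "'h::complex_normed_vector \<Rightarrow> 'h seq \<Rightarrow> 'h seq"
  where "seq_cons a x = Bcontfun (\<lambda>i. case i of 0 \<Rightarrow> a | Suc k \<Rightarrow> apply_bcontfun x k)"

lemma apply_Bcontfun_nat:
  fixes f :: "nat \<Rightarrow> 'h::complex_normed_vector"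
  assumes "bounded (range f)" shows "apply_bcontfun (Bcontfun f) = f"
  using assms by (intro Bcontfun_inverse) (auto simp: bcontfun_def)

lemma apply_seq_of: "apply_bcontfun (seq_of m f) i = (if i < m then f i else 0)"
proof -
  have "range (\<lambda>i. if i < m then f i else 0) \<subseteq> insert 0 (f ` {..<m})" by auto
  then have "bounded (range (\<lambda>i. if i < m then f i else 0))"
    by (rule bounded_subset[rotated]) (simp add: finite_imp_bounded)
  then show ?thesis unfolding seq_of_def by (subst apply_Bcontfun_nat) auto
qed

lemma apply_seq_tl: "apply_bcontfun (seq_tl x) i = apply_bcontfun x (Suc i)"
proof -
  have "bounded (range (\<lambda>i. apply_bcontfun x (Suc i)))"
    by (rule bounded_subset[OF bounded_apply_bcontfun[of x]]) auto
  then show ?thesis unfolding seq_tl_def by (subst apply_Bcontfun_nat) auto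
qed

lemma apply_seq_cons:
  "apply_bcontfun (seq_cons a x) i = (case i of 0 \<Rightarrow> a | Suc k \<Rightarrow> apply_bcontfun x k)"
proof -
  have "range (\<lambda>i. case i of 0 \<Rightarrow> a | Suc k \<Rightarrow> apply_bcontfun x k)
      \<subseteq> insert a (range (apply_bcontfun x))" by (auto split: nat.splits)
  then have "bounded (range (\<lambda>i. case i of 0 \<Rightarrow> a | Suc k \<Rightarrow> apply_bcontfun x k))"
    by (rule bounded_subset[rotated]) simp
  then show ?thesis unfolding seq_cons_def by (subst apply_Bcontfun_nat) auto
qed

definition mat_op ::
  "nat \<Rightarrow> nat \<Rightarrow> (nat \<Rightarrow> nat \<Rightarrow> 'a::complex_normed_vector \<rightharpoonup> 'b::complex_normed_vector) \<Rightarrow> 'a seq \<rightharpoonup> 'b seq"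
  where "mat_op m n A x =
    (if x \<in> power_space n \<and> (\<forall>i<m. \<forall>j<n. apply_bcontfun x j \<in> dom (A i j))
     then Some (seq_of m (\<lambda>i. \<Sum>j<n. the (A i j (apply_bcontfun x j)))) else None)"

definition row_op ::
  "nat \<Rightarrow> (nat \<Rightarrow> 'a::complex_normed_vector \<rightharpoonup> 'b::complex_normed_vector) \<Rightarrow> 'a seq \<rightharpoonup> 'b"
  where "row_op n A x =
    (if x \<in> power_space n \<and> (\<forall>j<n. apply_bcontfun x j \<in> dom (A j))
     then Some (\<Sum>j<n. the (A j (apply_bcontfun x j))) else None)"

definition col_op ::
  "nat \<Rightarrow> (nat \<Rightarrow> 'a::complex_normed_vector \<rightharpoonup> 'b::complex_normed_vector) \<Rightarrow> 'a \<rightharpoonup> 'b seq"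
  where "col_op m A y =
    (if \<forall>i<m. y \<in> dom (A i) then Some (seq_of m (\<lambda>i. the (A i y))) else None)"

text \<open>The operator \<open>[[A, B], [C, D]]\<close> on its natural domain.\<close>

definition block_op ::
  "('a \<rightharpoonup> 'c::plus) \<Rightarrow> ('b \<rightharpoonup> 'c) \<Rightarrow> ('a \<rightharpoonup> 'd::plus) \<Rightarrow> ('b \<rightharpoonup> 'd) \<Rightarrow> 'a \<times> 'b \<rightharpoonup> 'c \<times> 'd"
  where "block_op A B C D = (\<lambda>(x, y).
    if x \<in> dom A \<inter> dom C \<and> y \<in> dom B \<inter> dom D
    then Some (the (A x) + the (B y), the (C x) + the (D y)) else None)"

text \<open>The matrix \<open>[[A, B], [C, D]]\<close> whose first block \<open>A\<close> has size \<open>p \<times> q\<close>.\<close>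

definition four_blocks ::
  "nat \<Rightarrow> nat \<Rightarrow> (nat \<Rightarrow> nat \<Rightarrow> 'x) \<Rightarrow> (nat \<Rightarrow> nat \<Rightarrow> 'x) \<Rightarrow> (nat \<Rightarrow> nat \<Rightarrow> 'x) \<Rightarrow> (nat \<Rightarrow> nat \<Rightarrow> 'x)
    \<Rightarrow> nat \<Rightarrow> nat \<Rightarrow> 'x"
  where "four_blocks p q A B C D i j =
    (if i < p then (if j < q then A i j else B i (j - q))
     else (if j < q then C (i - p) j else D (i - p) (j - q)))"

definition id_mat :: "nat \<Rightarrow> nat \<Rightarrow> 'h::complex_normed_vector \<rightharpoonup> 'h"
  where "id_mat i j = (if i = j then scalar_op 1 else zero_op)"

definition zero_mat :: "nat \<Rightarrow> nat \<Rightarrow> 'h::complex_normed_vector \<rightharpoonup> 'h"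
  where "zero_mat i j = zero_op"


section \<open>The operator functions of the theorem\<close>

definition P_hat :: "nat \<Rightarrow> (nat \<Rightarrow> 'h \<rightharpoonup> 'h) \<Rightarrow> nat \<Rightarrow> 'h::complex_normed_vector \<rightharpoonup> 'h"
  where "P_hat d P i = op_inv (P d) \<circ>\<^sub>m P i"

definition P_block ::
  "nat \<Rightarrow> (nat \<Rightarrow> 'h \<rightharpoonup> 'h) \<Rightarrow> (complex \<Rightarrow> 'k \<rightharpoonup> 'h) \<Rightarrow> (nat \<Rightarrow> 'h \<rightharpoonup> 'm) \<Rightarrow> (complex \<Rightarrow> 'k \<rightharpoonup> 'm)
    \<Rightarrow> complex \<Rightarrow> 'h::complex_normed_vector \<times> 'k::complex_normed_vector \<rightharpoonup> 'h \<times> 'm::complex_normed_vector"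
  where "P_block d P X Q Z \<mu> =
    block_op (op_poly {..d} P \<mu>) (X \<mu>) (op_poly {..<d} Q \<mu>) (Z \<mu>)"

definition T_mat :: "nat \<Rightarrow> (nat \<Rightarrow> 'h \<rightharpoonup> 'h) \<Rightarrow> complex \<Rightarrow> nat \<Rightarrow> nat \<Rightarrow> 'h::complex_normed_vector \<rightharpoonup> 'h"
  where "T_mat d P \<mu> i j =
    (if i = 0 \<and> j = 0 then (-1) *\<^sub>o P_hat d P (d - 1) +\<^sub>o scalar_op (- \<mu>)
     else if i = 0 then (-1) *\<^sub>o P_hat d P (d - 1 - j)
     else if i = j then scalar_op (- \<mu>)
     else if i = Suc j then scalar_op 1
     else zero_op)"

definition T_block ::
  "nat \<Rightarrow> (nat \<Rightarrow> 'h \<rightharpoonup> 'h) \<Rightarrow> (complex \<Rightarrow> 'k \<rightharpoonup> 'h) \<Rightarrow> (nat \<Rightarrow> 'h \<rightharpoonup> 'm) \<Rightarrow> (complex \<Rightarrow> 'k \<rightharpoonup> 'm)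
    \<Rightarrow> complex \<Rightarrow> 'h::complex_normed_vector seq \<times> 'k::complex_normed_vector \<rightharpoonup> 'h seq \<times> 'm::complex_normed_vector"
  where "T_block d P X Q Z \<mu> =
    block_op
      (mat_op d d (T_mat d P \<mu>))
      (col_op d (\<lambda>i. if i = 0 then (-1) *\<^sub>o (op_inv (P d) \<circ>\<^sub>m X \<mu>) else zero_op))
      (row_op d (\<lambda>j. Q (d - 1 - j)))
      (Z \<mu>)"

definition N_mat :: "complex \<Rightarrow> nat \<Rightarrow> nat \<Rightarrow> 'h::complex_normed_vector \<rightharpoonup> 'h"
  where "N_mat \<mu> i j =
    (if i = j then scalar_op (- \<mu>) else if i = Suc j then scalar_op 1 else zero_op)"

text \<open>For \<open>l = d\<close> the truncated difference \<open>d - 1 - l = 0\<close> agrees with the convention that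
  powers with a negative exponent are trivial.\<close>

definition W_mat :: "nat \<Rightarrow> nat \<Rightarrow> complex \<Rightarrow> nat \<Rightarrow> nat \<Rightarrow> 'h::complex_normed_vector \<rightharpoonup> 'h"
  where "W_mat d l \<mu> = four_blocks (d - 1 - l) (d - 1 - l) id_mat zero_mat zero_mat (N_mat \<mu>)"

definition W_op :: "nat \<Rightarrow> nat \<Rightarrow> complex \<Rightarrow> 'h::complex_normed_vector seq \<rightharpoonup> 'h seq"
  where "W_op d l \<mu> = mat_op (max (d - 1) l) (max (d - 1) l) (W_mat d l \<mu>)"

text \<open>The number of copies of \<open>'h\<close> on which \<open>P_ext\<close> acts; it equals \<open>d\<close> for \<open>l < d\<close> and
  \<open>d + 1\<close> for \<open>l = d\<close>.\<close>

definition ext_dim :: "nat \<Rightarrow> nat \<Rightarrow> nat"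
  where "ext_dim d l = Suc (max (d - 1) l)"

definition P_ext ::
  "nat \<Rightarrow> nat \<Rightarrow> (nat \<Rightarrow> 'h \<rightharpoonup> 'h) \<Rightarrow> (complex \<Rightarrow> 'k \<rightharpoonup> 'h) \<Rightarrow> (nat \<Rightarrow> 'h \<rightharpoonup> 'm) \<Rightarrow> (complex \<Rightarrow> 'k \<rightharpoonup> 'm)
    \<Rightarrow> complex \<Rightarrow> 'h::complex_normed_vector seq \<times> 'k::complex_normed_vector \<rightharpoonup> 'h seq \<times> 'm::complex_normed_vector"
  where "P_ext d l P X Q Z \<mu> =
    block_op
      (mat_op (ext_dim d l) (ext_dim d l)
        (four_blocks 1 1 (\<lambda>i j. op_poly {..d} P \<mu>) zero_mat zero_mat (W_mat d l \<mu>)))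
      (col_op (ext_dim d l) (\<lambda>i. if i = 0 then X \<mu> else zero_op))
      (row_op (ext_dim d l) (\<lambda>j. if j = 0 then op_poly {..<d} Q \<mu> else zero_op))
      (Z \<mu>)"

text \<open>The reordering under which \<open>P_ext\<close> becomes the direct sum of \<open>P_block\<close> and \<open>W_op\<close>.\<close>

definition reorder :: "'h::complex_normed_vector seq \<times> 'k \<Rightarrow> ('h \<times> 'k) \<times> 'h seq"
  where "reorder = (\<lambda>(x, y). ((apply_bcontfun x 0, y), seq_tl x))"

text \<open>The direct sum of \<open>P_d\<close> and \<open>T_block\<close>, with \<open>'h \<times> ('h seq \<times> 'k)\<close> regrouped as
  \<open>'h seq \<times> 'k\<close> by putting the component in \<open>'h\<close> in front of the sequence.\<close>

definition PT_dsum ::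
  "nat \<Rightarrow> (nat \<Rightarrow> 'h \<rightharpoonup> 'h) \<Rightarrow> (complex \<Rightarrow> 'k \<rightharpoonup> 'h) \<Rightarrow> (nat \<Rightarrow> 'h \<rightharpoonup> 'm) \<Rightarrow> (complex \<Rightarrow> 'k \<rightharpoonup> 'm)
    \<Rightarrow> complex \<Rightarrow> 'h::complex_normed_vector seq \<times> 'k::complex_normed_vector \<rightharpoonup> 'h seq \<times> 'm::complex_normed_vector"
  where "PT_dsum d P X Q Z \<mu> = (\<lambda>(x, y).
    map_option (\<lambda>(a, u, v). (seq_cons a u, v))
      (op_dsum (P d) (T_block d P X Q Z \<mu>) (apply_bcontfun x 0, seq_tl x, y)))"

definition T_star ::
  "nat \<Rightarrow> nat \<Rightarrow> (nat \<Rightarrow> 'h \<rightharpoonup> 'h) \<Rightarrow> (complex \<Rightarrow> 'k \<rightharpoonup> 'h) \<Rightarrow> (nat \<Rightarrow> 'h \<rightharpoonup> 'm) \<Rightarrow> (complex \<Rightarrow> 'k \<rightharpoonup> 'm)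
    \<Rightarrow> complex \<Rightarrow> 'h::complex_normed_vector seq \<times> 'k::complex_normed_vector \<rightharpoonup> 'h seq \<times> 'm::complex_normed_vector"
  where "T_star d l P X Q Z = (if l < d then T_block d P X Q Z else PT_dsum d P X Q Z)"


section \<open>The transformation functions\<close>

definition E_alpha :: "nat \<Rightarrow> (nat \<Rightarrow> 'h \<rightharpoonup> 'h) \<Rightarrow> complex \<Rightarrow> nat \<Rightarrow> nat \<Rightarrow> 'h::complex_normed_vector \<rightharpoonup> 'h"
  where "E_alpha d P \<mu> i j =
    (if i = 0 then (-1) *\<^sub>o op_sum (\<lambda>k. \<mu> ^ k *\<^sub>o P (d - j + k)) {..j}
     else if i \<le> j then scalar_op (\<mu> ^ (j - i))
     else zero_op)"

definition F_alpha :: "nat \<Rightarrow> complex \<Rightarrow> nat \<Rightarrow> nat \<Rightarrow> 'h::complex_normed_vector \<rightharpoonup> 'h"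
  where "F_alpha d \<mu> i j =
    (if j = 0 then scalar_op (\<mu> ^ (d - 1 - i))
     else if j = Suc i then scalar_op 1
     else zero_op)"

definition E_beta :: "nat \<Rightarrow> (nat \<Rightarrow> 'h \<rightharpoonup> 'h) \<Rightarrow> complex \<Rightarrow> nat \<Rightarrow> nat \<Rightarrow> 'h::complex_normed_vector \<rightharpoonup> 'h"
  where "E_beta l P \<mu> i j =
    (if i = 0 then op_sum (\<lambda>k. (1 / \<mu> ^ (l - j - k)) *\<^sub>o P k) {..<l - j} else zero_op)"

definition F_beta :: "nat \<Rightarrow> complex \<Rightarrow> nat \<Rightarrow> nat \<Rightarrow> 'h::complex_normed_vector \<rightharpoonup> 'h"
  where "F_beta l \<mu> i j = (if j = 0 then scalar_op (\<mu> ^ (l - 1 - i)) else zero_op)"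

definition E_gamma :: "nat \<Rightarrow> (nat \<Rightarrow> 'h \<rightharpoonup> 'h) \<Rightarrow> nat \<Rightarrow> nat \<Rightarrow> 'h::complex_normed_vector \<rightharpoonup> 'h"
  where "E_gamma d P i j = (if i = 0 then op_inv (P d) else zero_op)"

definition F_gamma :: "nat \<Rightarrow> (nat \<Rightarrow> 'h \<rightharpoonup> 'h) \<Rightarrow> nat \<Rightarrow> nat \<Rightarrow> 'h::complex_normed_vector \<rightharpoonup> 'h"
  where "F_gamma d P i j = P_hat d P (d - 1 - j)"

definition E_mat :: "nat \<Rightarrow> nat \<Rightarrow> (nat \<Rightarrow> 'h \<rightharpoonup> 'h) \<Rightarrow> complex \<Rightarrow> nat \<Rightarrow> nat \<Rightarrow> 'h::complex_normed_vector \<rightharpoonup> 'h"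
  where "E_mat d l P \<mu> =
    (if l = 0 then E_alpha d P \<mu>
     else if l < d then four_blocks (d - l) (d - l) (E_alpha d P \<mu>) (E_beta l P \<mu>) zero_mat id_mat
     else four_blocks 1 1 (\<lambda>i j. (1 / \<mu> ^ d) *\<^sub>o (op_poly {..d} P \<mu> \<circ>\<^sub>m op_inv (P d)))
       (E_beta l P \<mu>) (E_gamma d P) id_mat)"

definition F_mat :: "nat \<Rightarrow> nat \<Rightarrow> (nat \<Rightarrow> 'h \<rightharpoonup> 'h) \<Rightarrow> complex \<Rightarrow> nat \<Rightarrow> nat \<Rightarrow> 'h::complex_normed_vector \<rightharpoonup> 'h"
  where "F_mat d l P \<mu> =
    (if l = 0 then F_alpha d \<mu>
     else if l < d then four_blocks (d - l) (d - l) (F_alpha d \<mu>) zero_mat (F_beta l \<mu>) id_mat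
     else four_blocks 1 1 (\<lambda>i j. scalar_op (\<mu> ^ d) +\<^sub>o op_poly {..<d} (P_hat d P) \<mu>)
       (F_gamma d P) (F_beta l \<mu>) id_mat)"

definition Et_alpha ::
  "nat \<Rightarrow> (nat \<Rightarrow> 'h \<rightharpoonup> 'm) \<Rightarrow> complex \<Rightarrow> nat \<Rightarrow> 'h::complex_normed_vector \<rightharpoonup> 'm::complex_normed_vector"
  where "Et_alpha d Q \<mu> j =
    (if j = 0 then zero_op else (-1) *\<^sub>o op_sum (\<lambda>k. \<mu> ^ k *\<^sub>o Q (d - j + k)) {..<j})"

definition Et_beta ::
  "nat \<Rightarrow> (nat \<Rightarrow> 'h \<rightharpoonup> 'm) \<Rightarrow> complex \<Rightarrow> nat \<Rightarrow> 'h::complex_normed_vector \<rightharpoonup> 'm::complex_normed_vector"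
  where "Et_beta l Q \<mu> j = op_sum (\<lambda>k. (1 / \<mu> ^ (l - j - k)) *\<^sub>o Q k) {..<l - j}"

definition Et_row ::
  "nat \<Rightarrow> nat \<Rightarrow> (nat \<Rightarrow> 'h \<rightharpoonup> 'h) \<Rightarrow> (nat \<Rightarrow> 'h \<rightharpoonup> 'm) \<Rightarrow> complex
    \<Rightarrow> nat \<Rightarrow> 'h::complex_normed_vector \<rightharpoonup> 'm::complex_normed_vector"
  where "Et_row d l P Q \<mu> j =
    (if l = 0 then Et_alpha d Q \<mu> j
     else if l < d then (if j < d - l then Et_alpha d Q \<mu> j else Et_beta l Q \<mu> (j - (d - l)))
     else (if j = 0 then (1 / \<mu> ^ d) *\<^sub>o (op_poly {..<d} Q \<mu> \<circ>\<^sub>m op_inv (P d))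
           else Et_beta l Q \<mu> (j - 1)))"

definition Ft_col ::
  "nat \<Rightarrow> nat \<Rightarrow> (nat \<Rightarrow> 'h \<rightharpoonup> 'h) \<Rightarrow> (complex \<Rightarrow> 'k \<rightharpoonup> 'h) \<Rightarrow> complex
    \<Rightarrow> nat \<Rightarrow> 'k::complex_normed_vector \<rightharpoonup> 'h::complex_normed_vector"
  where "Ft_col d l P X \<mu> i =
    (if l = d \<and> i = 0 then op_closure (op_inv (P d) \<circ>\<^sub>m X \<mu>) else zero_op)"

definition E_block ::
  "nat \<Rightarrow> nat \<Rightarrow> (nat \<Rightarrow> 'h \<rightharpoonup> 'h) \<Rightarrow> (nat \<Rightarrow> 'h \<rightharpoonup> 'm) \<Rightarrow> complex
    \<Rightarrow> 'h::complex_normed_vector seq \<times> 'm::complex_normed_vector \<rightharpoonup> 'h seq \<times> 'm"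
  where "E_block d l P Q \<mu> =
    block_op (mat_op (ext_dim d l) (ext_dim d l) (E_mat d l P \<mu>)) zero_op
      (row_op (ext_dim d l) (Et_row d l P Q \<mu>)) (scalar_op 1)"

definition F_block ::
  "nat \<Rightarrow> nat \<Rightarrow> (nat \<Rightarrow> 'h \<rightharpoonup> 'h) \<Rightarrow> (complex \<Rightarrow> 'k \<rightharpoonup> 'h) \<Rightarrow> complex
    \<Rightarrow> 'h::complex_normed_vector seq \<times> 'k::complex_normed_vector \<rightharpoonup> 'h seq \<times> 'k"
  where "F_block d l P X \<mu> =
    block_op (mat_op (ext_dim d l) (ext_dim d l) (F_mat d l P \<mu>))
      (col_op (ext_dim d l) (Ft_col d l P X \<mu>)) zero_op (scalar_op 1)"

end

theory Submission
  imports Defs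
begin

text \<open>
  An operator with domain is written \<open>op_on D f\<close> with \<open>f\<close> linear on the whole space, which is
  possible by extending along a Hamel basis. The factorization then becomes an identity between
  everywhere defined linear maps, and the domains are compared separately.

  If \<open>w\<close> is the image of a vector with first component \<open>v\<close> under \<open>F(\<lambda>)\<close>, then the lower rows of
  \<open>T(\<lambda>)\<close> produce the differences \<open>w (j - 1) - \<lambda> w j\<close>. The entries of the first row of \<open>E\<close> and of
  \<open>Et\<close> satisfy Horner type recursions with the coefficients of \<open>P\<close> and \<open>Q\<close>, so their sums against
  these differences telescope, from the top coefficient down to \<open>l + 1\<close> in the columns of
  \<open>E\<^sub>\<alpha>\<close> and from the bottom coefficient up to \<open>l - 1\<close> in those of \<open>E\<^sub>\<beta>\<close>. The two halves meet at
  the component \<open>\<lambda>\<^sup>l v\<close>, the only one to which the possibly unbounded coefficients with index \<open>l\<close>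
  are applied. The matrix \<open>E\<close> for \<open>l < d\<close> is block triangular, \<open>F\<close> is so up to a cyclic
  permutation of the rows, and for \<open>l = d\<close> the Schur complements of their lower right corners
  are \<open>I\<close> and \<open>\<lambda>\<^sup>d\<close>; this gives the bounded inverses.
\<close>

section \<open>Bounded complex linear maps\<close>

interpretation complex_vs: vector_space "scaleC :: complex \<Rightarrow> 'a::complex_normed_vector \<Rightarrow> 'a"
proof
  show "1 *\<^sub>C x = x" for x :: 'a
    using scaleC_of_real[of 1 x] by simp
qed (rule scaleC_add_right scaleC_add_left scaleC_scaleC)+

interpretation complex_vs_pair: vector_space_pair
  "scaleC :: complex \<Rightarrow> 'a::complex_normed_vector \<Rightarrow> 'a"
  "scaleC :: complex \<Rightarrow> 'b::complex_normed_vector \<Rightarrow> 'b" ..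

abbreviation clinear :: "('a::complex_normed_vector \<Rightarrow> 'b::complex_normed_vector) \<Rightarrow> bool"
  where "clinear \<equiv> Vector_Spaces.linear scaleC scaleC"

lemma clinearI:
  assumes "\<And>x y. f (x + y) = f x + f y" "\<And>c x. f (c *\<^sub>C x) = c *\<^sub>C f x"
  shows "clinear f"
  using assms by (simp add: Vector_Spaces.linear_iff complex_vs.vector_space_axioms)

lemmas clinear_simps = complex_vs_pair.linear_add complex_vs_pair.linear_diff
  complex_vs_pair.linear_neg complex_vs_pair.linear_0 complex_vs_pair.linear_scale
  complex_vs_pair.linear_sum

text \<open>A Hamel basis of \<open>D\<close> is independent in the whole space, so a linear map may
  be prescribed on it. The extension \<open>g\<close> is purely algebraic and comes with no
  bound.\<close>

lemma clinear_extend: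
  assumes "complex_vs.subspace D"
    and add: "\<And>x y. x \<in> D \<Longrightarrow> y \<in> D \<Longrightarrow> f (x + y) = f x + f y"
    and scale: "\<And>c x. x \<in> D \<Longrightarrow> f (c *\<^sub>C x) = c *\<^sub>C f x"
  obtains g where "clinear g" "\<And>x. x \<in> D \<Longrightarrow> g x = f x"
proof -
  obtain B where B: "B \<subseteq> D" "complex_vs.independent B" "D \<subseteq> complex_vs.span B"
    using complex_vs.maximal_independent_subset by blast
  have span: "complex_vs.span B \<subseteq> D"
    using B(1) assms(1) by (rule complex_vs.span_minimal)
  obtain g where g: "clinear g" "\<And>b. b \<in> B \<Longrightarrow> g b = f b"
    using complex_vs_pair.linear_independent_extend[OF B(2), of f] by blast
  \<comment> \<open>Membership in \<open>D\<close> is carried through the span induction because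
    \<open>f\<close> is additive and homogeneous only there.\<close>
  have "x \<in> D \<and> g x = f x" if "x \<in> complex_vs.span B" for x
    using that
  proof (induct rule: complex_vs.span_induct_alt)
    case base
    \<comment> \<open>Homogeneity with the scalar 0 forces \<open>f 0 = 0\<close>.\<close>
    have "0 \<in> D" using assms(1) by (rule complex_vs.subspace_0)
    then show ?case using scale[of 0 0] g(1) by (simp add: clinear_simps)
  next
    case (step c b y)
    then have "b \<in> D" using B(1) by blast
    then have "c *\<^sub>C b \<in> D" using assms(1) by (simp add: complex_vs.subspace_scale)
    then show ?case
      using step \<open>b \<in> D\<close> assms(1) g by (simp add: add scale clinear_simps complex_vs.subspace_add)
  qed
  with that g(1) B(3) show thesis by blast
qed

lemma clinear_compose: "clinear f \<Longrightarrow> clinear g \<Longrightarrow> clinear (\<lambda>x. f (g x))"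
  by (simp add: clinearI clinear_simps)

definition bounded_clinear :: "('a::complex_normed_vector \<Rightarrow> 'b::complex_normed_vector) \<Rightarrow> bool"
  where "bounded_clinear f \<longleftrightarrow> clinear f \<and> (\<exists>K. \<forall>x. norm (f x) \<le> K * norm x)"

lemma bounded_clinearI:
  "clinear f \<Longrightarrow> (\<And>x. norm (f x) \<le> K * norm x) \<Longrightarrow> bounded_clinear f"
  by (auto simp: bounded_clinear_def)

lemma bounded_clinear_clinear: "bounded_clinear f \<Longrightarrow> clinear f"
  by (simp add: bounded_clinear_def)

text \<open>The constant in the definition may be negative on a trivial space; clipped at 0 it can
  be multiplied into the estimate of an inner map.\<close>

lemma bounded_clinear_nonneg_bound:
  assumes "bounded_clinear f"
  obtains K where "K \<ge> 0" "\<And>x. norm (f x) \<le> K * norm x"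
proof -
  obtain K where K: "norm (f x) \<le> K * norm x" for x
    using assms by (auto simp: bounded_clinear_def)
  have "norm (f x) \<le> max K 0 * norm x" for x
    by (rule order_trans[OF K mult_right_mono]) auto
  with that[of "max K 0"] show thesis by simp
qed

lemma bounded_clinear_compose:
  assumes "bounded_clinear f" "bounded_clinear g"
  shows "bounded_clinear (\<lambda>x. f (g x))"
proof -
  obtain K where K: "K \<ge> 0" "\<And>x. norm (f x) \<le> K * norm x"
    using assms(1) bounded_clinear_nonneg_bound by blast
  obtain L where L: "\<And>x. norm (g x) \<le> L * norm x"
    using assms(2) bounded_clinear_nonneg_bound by blast
  have "norm (f (g x)) \<le> K * L * norm x" for x
    using K(2)[of "g x"] mult_left_mono[OF L K(1), of x] by (simp add: mult.assoc)
  with clinear_compose[OF assms[THEN bounded_clinear_clinear]] show ?thesis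
    by (rule bounded_clinearI)
qed

lemma bounded_clinear_add:
  assumes "bounded_clinear f" "bounded_clinear g"
  shows "bounded_clinear (\<lambda>x. f x + g x)"
proof -
  obtain K L where K: "norm (f x) \<le> K * norm x" and L: "norm (g x) \<le> L * norm x" for x
    using assms by (auto simp: bounded_clinear_def)
  have "norm (f x + g x) \<le> (K + L) * norm x" for x
    using norm_triangle_le[OF add_mono[OF K L]] by (simp add: distrib_right)
  moreover have "clinear (\<lambda>x. f x + g x)"
    using assms by (simp add: bounded_clinear_clinear complex_vs_pair.linear_compose_add)
  ultimately show ?thesis by (rule bounded_clinearI[rotated])
qed

lemma bounded_clinear_zero: "bounded_clinear (\<lambda>x. 0)"
  by (rule bounded_clinearI[of _ 0]) (auto intro: clinearI)

lemma bounded_clinear_ident: "bounded_clinear (\<lambda>x. x)"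
  by (rule bounded_clinearI[of _ 1]) (auto intro: clinearI)

lemma bounded_clinear_scaleC: "bounded_clinear f \<Longrightarrow> bounded_clinear (\<lambda>x. c *\<^sub>C f x)"
  by (rule bounded_clinear_compose[of "scaleC c"])
    (auto intro!: bounded_clinearI[of _ "cmod c"] clinearI
      simp: scaleC_add_right scaleC_scaleC norm_scaleC mult.commute)

lemma bounded_clinear_minus: "bounded_clinear f \<Longrightarrow> bounded_clinear (\<lambda>x. - f x)"
  using bounded_clinear_scaleC[of f "-1"] by simp

lemma bounded_clinear_diff:
  "bounded_clinear f \<Longrightarrow> bounded_clinear g \<Longrightarrow> bounded_clinear (\<lambda>x. f x - g x)"
  using bounded_clinear_add[OF _ bounded_clinear_minus, of f g] by simp

lemma bounded_clinear_sum:
  "(\<And>i. i \<in> I \<Longrightarrow> bounded_clinear (f i)) \<Longrightarrow> bounded_clinear (\<lambda>x. \<Sum>i\<in>I. f i x)"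
  by (induct I rule: infinite_finite_induct) (auto intro: bounded_clinear_zero bounded_clinear_add)

lemma bounded_clinear_fst: "bounded_clinear g \<Longrightarrow> bounded_clinear (\<lambda>x. fst (g x))"
  by (rule bounded_clinear_compose[of fst])
    (auto intro!: bounded_clinearI[of _ 1] clinearI simp: scaleC_prod_def norm_fst_le)

lemma bounded_clinear_snd: "bounded_clinear g \<Longrightarrow> bounded_clinear (\<lambda>x. snd (g x))"
  by (rule bounded_clinear_compose[of snd])
    (auto intro!: bounded_clinearI[of _ 1] clinearI simp: scaleC_prod_def norm_snd_le)

lemma bounded_clinear_Pair:
  assumes "bounded_clinear f" "bounded_clinear g"
  shows "bounded_clinear (\<lambda>x. (f x, g x))"
proof -
  have "bounded_clinear (\<lambda>y::'b. (y, 0::'c))"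
    by (rule bounded_clinearI[of _ 1]) (auto intro!: clinearI simp: scaleC_prod_def)
  moreover have "bounded_clinear (\<lambda>y::'c. (0::'b, y))"
    by (rule bounded_clinearI[of _ 1]) (auto intro!: clinearI simp: scaleC_prod_def)
  ultimately show ?thesis
    using bounded_clinear_add[OF bounded_clinear_compose bounded_clinear_compose,
        OF _ assms(1) _ assms(2), of "\<lambda>y. (y, 0)" "\<lambda>y. (0, y)"] by simp
qed

section \<open>Components and columns in finite powers of a space\<close>

lemma bounded_clinear_apply:
  assumes "bounded_clinear g"
  shows "bounded_clinear (\<lambda>x. apply_bcontfun (g x) i)"
  by (rule bounded_clinear_compose[OF _ assms])
    (auto intro!: bounded_clinearI[of _ 1] clinearI simp: apply_scaleC_bcontfun norm_bounded)

lemma seq_of_eqI: "(\<And>i. i < m \<Longrightarrow> f i = g i) \<Longrightarrow> seq_of m f = seq_of m g"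
  by (rule bcontfun_eqI) (simp add: apply_seq_of)

lemma seq_of_add: "seq_of m f + seq_of m g = seq_of m (\<lambda>i. f i + g i)"
  by (rule bcontfun_eqI) (simp add: apply_seq_of)

lemma seq_of_in_power_space: "seq_of m f \<in> power_space m"
  by (simp add: power_space_def apply_seq_of)

lemma seq_of_apply: "x \<in> power_space m \<Longrightarrow> seq_of m (apply_bcontfun x) = x"
  by (rule bcontfun_eqI) (simp add: apply_seq_of power_space_def)

text \<open>A finite column is the sum of its entries placed by the coordinate embeddings, and these
  do not increase the norm since the power carries the maximum norm.\<close>

lemma bounded_clinear_seq_of:
  assumes "\<And>i. i < m \<Longrightarrow> bounded_clinear (f i)"
  shows "bounded_clinear (\<lambda>x. seq_of m (\<lambda>i. f i x))"
proof -
  have unit: "bounded_clinear (\<lambda>y. seq_of m (\<lambda>j. if j = i then y else 0))" for i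
  proof (rule bounded_clinearI)
    show "clinear (\<lambda>y. seq_of m (\<lambda>j. if j = i then y else 0))"
      by (rule clinearI; rule bcontfun_eqI) (simp_all add: apply_seq_of apply_scaleC_bcontfun)
    show "norm (seq_of m (\<lambda>j. if j = i then y else 0)) \<le> 1 * norm y" for y
      by (rule norm_bound) (simp add: apply_seq_of)
  qed
  have apply_sum: "apply_bcontfun (\<Sum>i\<in>I. g i) j = (\<Sum>i\<in>I. apply_bcontfun (g i) j)"
    for g :: "nat \<Rightarrow> 'b seq" and I j
    by (induct I rule: infinite_finite_induct) auto
  have "seq_of m (\<lambda>i. f i x) = (\<Sum>i<m. seq_of m (\<lambda>j. if j = i then f i x else 0))" for x
    by (rule bcontfun_eqI) (simp add: apply_sum apply_seq_of)
  then show ?thesis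
    using bounded_clinear_sum[of "{..<m}" "\<lambda>i x. seq_of m (\<lambda>j. if j = i then f i x else 0)"]
      bounded_clinear_compose[OF unit assms] by simp
qed

text \<open>The condition does not depend on the argument: it is a comparison of indices. Each
  branch may use it, so bounds that hold only for certain indices suffice.\<close>

lemma bounded_clinear_if:
  "(b \<Longrightarrow> bounded_clinear f) \<Longrightarrow> (\<not> b \<Longrightarrow> bounded_clinear g)
    \<Longrightarrow> bounded_clinear (\<lambda>x. if b then f x else g x)"
  by (cases b) simp_all

lemmas bounded_clinear_intros = bounded_clinear_if bounded_clinear_zero bounded_clinear_ident
  bounded_clinear_scaleC bounded_clinear_minus bounded_clinear_add bounded_clinear_diff
  bounded_clinear_sum bounded_clinear_fst bounded_clinear_snd bounded_clinear_Pair
  bounded_clinear_apply bounded_clinear_seq_of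

section \<open>Operators as restrictions of linear maps\<close>

definition op_on :: "'a set \<Rightarrow> ('a \<Rightarrow> 'b) \<Rightarrow> 'a \<rightharpoonup> 'b"
  where "op_on D f x = (if x \<in> D then Some (f x) else None)"

lemma dom_op_on [simp]: "dom (op_on D f) = D"
  by (auto simp: op_on_def dom_def)

lemma ran_op_on: "ran (op_on D f) = f ` D"
  by (auto simp: op_on_def ran_def)

lemma op_on_eqI: "D = D' \<Longrightarrow> (\<And>x. x \<in> D' \<Longrightarrow> f x = g x) \<Longrightarrow> op_on D f = op_on D' g"
  by (auto simp: op_on_def)

lemma op_on_the: "A = op_on (dom A) (\<lambda>x. the (A x))"
  by (rule ext) (auto simp: op_on_def dom_def)

lemma lin_ops_op_on:
  assumes "clinear f" "complex_vs.subspace D" "D \<subseteq> U" "f ` D \<subseteq> V"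
  shows "op_on D f \<in> lin_ops U V"
  using assms unfolding lin_ops_def ran_op_on mem_Collect_eq dom_op_on
  by (auto simp: op_on_def clinear_simps complex_vs.subspace_add complex_vs.subspace_scale
      complex_vs.subspace_0)

lemma bdd_ops_op_on:
  assumes "bounded_clinear f" "complex_vs.subspace U" "f ` U \<subseteq> V"
  shows "op_on U f \<in> bdd_ops U V"
  using assms lin_ops_op_on[of f U U V] unfolding bdd_ops_def
  by (auto simp: bounded_clinear_def op_on_def)

lemma op_inv_op_on:
  assumes "\<And>x. x \<in> D \<Longrightarrow> g (f x) = x"
  shows "op_inv (op_on D f) = op_on (f ` D) g"
proof
  fix y
  have "(THE x. op_on D f x = Some y) = g y" if "y \<in> f ` D"
    using that by (intro the_equality) (auto simp: op_on_def assms dest!: arg_cong[where f = g] split: if_splits)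
  then show "op_inv (op_on D f) y = op_on (f ` D) g y"
    unfolding op_inv_def ran_op_on by (simp add: op_on_def)
qed

text \<open>With an explicit two-sided inverse \<open>g\<close> the image of \<open>U\<close> is all
  of \<open>V\<close> and \<open>op_inv\<close> is the restriction of \<open>g\<close> to
  \<open>V\<close>, so its boundedness is that of a formula.\<close>

lemma invertible_op_op_on:
  assumes f: "bounded_clinear f" and g: "bounded_clinear g"
    and sub: "complex_vs.subspace U" "complex_vs.subspace V"
    and maps: "f ` U \<subseteq> V" "g ` V \<subseteq> U"
    and inv: "\<And>x. x \<in> U \<Longrightarrow> g (f x) = x" "\<And>y. y \<in> V \<Longrightarrow> f (g y) = y"
  shows "invertible_op U V (op_on U f)"
proof -
  have V: "f ` U = V" using maps inv by force
  have "op_inv (op_on U f) = op_on V g"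
    using op_inv_op_on[of U g f] inv(1) V by simp
  moreover have "inj_on f U" using inv(1) by (rule inj_on_inverseI)
  then have "inj_on (op_on U f) U"
    by (simp add: inj_on_def op_on_def)
  moreover have "op_on U f \<in> lin_ops U V"
    using bdd_ops_op_on[OF f sub(1) maps(1)] by (simp add: bdd_ops_def)
  ultimately show ?thesis
    using V bdd_ops_op_on[OF g sub(2) maps(2)] by (simp add: invertible_op_def ran_op_on)
qed

lemma lin_opsE:
  assumes "A \<in> lin_ops U V"
  obtains f where "clinear f" "complex_vs.subspace (dom A)" "A = op_on (dom A) f"
proof -
  \<comment> \<open>An equation \<open>A (x + y) = Some _\<close> already says that the domain is
    closed under addition; scaling is alike.\<close>
  have sub: "complex_vs.subspace (dom A)"
    using assms by (force simp: lin_ops_def complex_vs.subspace_def)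
  have "the (A (x + y)) = the (A x) + the (A y)" if "x \<in> dom A" "y \<in> dom A" for x y
    using assms that by (simp add: lin_ops_def)
  moreover have "the (A (c *\<^sub>C x)) = c *\<^sub>C the (A x)" if "x \<in> dom A" for c x
    using assms that by (simp add: lin_ops_def)
  ultimately obtain f where "clinear f" "\<And>x. x \<in> dom A \<Longrightarrow> f x = the (A x)"
    using clinear_extend[OF sub, of "\<lambda>x. the (A x)"] by blast
  with that sub op_on_eqI[of "dom A" "dom A" "\<lambda>x. the (A x)" f] op_on_the[of A]
  show thesis by simp
qed

lemma bdd_ops_UNIV_E:
  assumes "A \<in> bdd_ops UNIV UNIV"
  obtains f where "bounded_clinear f" "A = op_on UNIV f"
proof -
  from assms have A: "A \<in> lin_ops UNIV UNIV" "dom A = UNIV"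
    and bd: "\<exists>K. \<forall>x. norm (the (A x)) \<le> K * norm x" by (auto simp: bdd_ops_def)
  obtain f where f: "clinear f" "A = op_on UNIV f"
    using lin_opsE[OF A(1)] A(2) by metis
  with bd have "bounded_clinear f" by (simp add: bounded_clinear_def op_on_def)
  with f that show thesis by blast
qed

lemma op_scale_op_on: "c *\<^sub>o op_on D f = op_on D (\<lambda>x. c *\<^sub>C f x)"
  by (auto simp: op_scale_def op_on_def)

lemma op_plus_op_on: "op_on D f +\<^sub>o op_on D' g = op_on (D \<inter> D') (\<lambda>x. f x + g x)"
  by (auto simp: op_plus_def op_on_def)

lemma op_sum_op_on:
  assumes "\<And>i. i \<in> I \<Longrightarrow> A i = op_on (D i) (f i)"
  shows "op_sum A I = op_on {x. \<forall>i\<in>I. x \<in> D i} (\<lambda>x. \<Sum>i\<in>I. f i x)"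
  by (rule ext) (auto simp: op_sum_def op_on_def assms intro!: sum.cong)

lemma map_comp_op_on: "op_on D f \<circ>\<^sub>m op_on D' g = op_on {x \<in> D'. g x \<in> D} (\<lambda>x. f (g x))"
  by (auto simp: map_comp_def op_on_def)

lemma scalar_op_op_on: "scalar_op c = op_on UNIV (\<lambda>x. c *\<^sub>C x)"
  by (auto simp: scalar_op_def op_on_def)

lemma zero_op_op_on: "zero_op = op_on UNIV (\<lambda>x. 0)"
  by (auto simp: zero_op_def op_on_def)

lemma op_dsum_op_on:
  "op_dsum (op_on D f) (op_on D' g) = op_on (D \<times> D') (\<lambda>(x, y). (f x, g y))"
  by (auto simp: op_dsum_def op_on_def)

lemma block_op_op_on:
  "block_op (op_on D a) (op_on D' b) (op_on G c) (op_on G' e) =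
    op_on ((D \<inter> G) \<times> (D' \<inter> G')) (\<lambda>(x, y). (a x + b y, c x + e y))"
  by (auto simp: block_op_def op_on_def)

lemma mat_op_op_on:
  assumes "\<And>i j. i < m \<Longrightarrow> j < n \<Longrightarrow> A i j = op_on (D i j) (a i j)"
  shows "mat_op m n A =
    op_on {x \<in> power_space n. \<forall>i<m. \<forall>j<n. apply_bcontfun x j \<in> D i j}
      (\<lambda>x. seq_of m (\<lambda>i. \<Sum>j<n. a i j (apply_bcontfun x j)))"
  by (rule ext) (auto simp: mat_op_def op_on_def assms intro!: seq_of_eqI sum.cong)

lemma row_op_op_on:
  assumes "\<And>j. j < n \<Longrightarrow> A j = op_on (D j) (a j)"
  shows "row_op n A =
    op_on {x \<in> power_space n. \<forall>j<n. apply_bcontfun x j \<in> D j} (\<lambda>x. \<Sum>j<n. a j (apply_bcontfun x j))"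
  by (rule ext) (auto simp: row_op_def op_on_def assms intro!: sum.cong)

lemma col_op_op_on:
  assumes "\<And>i. i < m \<Longrightarrow> A i = op_on (D i) (a i)"
  shows "col_op m A = op_on {y. \<forall>i<m. y \<in> D i} (\<lambda>y. seq_of m (\<lambda>i. a i y))"
  by (rule ext) (auto simp: col_op_def op_on_def assms intro!: seq_of_eqI)

text \<open>An everywhere defined closure has exactly one value over each point, and the pair from
  the graph of \<open>A\<close> itself is a candidate for it.\<close>

lemma op_closure_eq:
  assumes "op_closure A \<in> bdd_ops UNIV UNIV" "A x = Some y"
  shows "op_closure A x = Some y"
proof -
  let ?G = "closure {(u, v). A u = Some v}"
  have "(x, y) \<in> ?G"
    using assms(2) by (intro subsetD[OF closure_subset]) simp
  moreover have "x \<in> dom (op_closure A)"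
    using assms(1) by (simp add: bdd_ops_def)
  then have "\<exists>!y. (x, y) \<in> ?G"
    by (auto simp: op_closure_def Let_def dom_def split: if_splits)
  ultimately show ?thesis
    by (simp add: op_closure_def Let_def the1_equality)
qed

lemma subspace_power_space: "complex_vs.subspace (power_space m)"
  by (simp add: complex_vs.subspace_def power_space_def apply_scaleC_bcontfun)

text \<open>Serves to compare domains: a nonzero power of \<open>\<mu>\<close> in front of a
  component does not affect its membership.\<close>

lemma subspace_scale_iff:
  assumes "complex_vs.subspace D" "c \<noteq> 0"
  shows "c *\<^sub>C y \<in> D \<longleftrightarrow> y \<in> D"
  using assms complex_vs.subspace_scale[OF assms(1), of "c *\<^sub>C y" "1 / c"]
    complex_vs.subspace_scale[OF assms(1), of y c] by auto

lemma subspace_Times: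
  assumes "complex_vs.subspace A" "complex_vs.subspace B"
  shows "complex_vs.subspace (A \<times> B)"
  using assms by (auto simp: complex_vs.subspace_def scaleC_prod_def zero_prod_def)


lemma subspace_vimage:
  assumes "clinear f" "complex_vs.subspace U" "complex_vs.subspace D"
  shows "complex_vs.subspace {v \<in> U. f v \<in> D}"
  using assms by (auto simp: complex_vs.subspace_def clinear_simps)

text \<open>Reduces equivalence at one point to total maps with explicit inverses \<open>gE\<close>,
  \<open>gF\<close>. The first premise holds both the factorization and the comparison of domains,
  because the domain given to \<open>S\<close> is the preimage of \<open>D\<close> under
  \<open>fF\<close>.\<close>

lemma equivalent_via_op_on:
  assumes S: "S \<mu> = op_on {v \<in> U. fF v \<in> D} (\<lambda>v. fE (fT (fF v)))"
    and T: "T \<mu> = op_on D fT" and E: "E \<mu> = op_on V' fE" and F: "F \<mu> = op_on U fF"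
    and fT: "clinear fT" "complex_vs.subspace D" "D \<subseteq> V" "fT ` D \<subseteq> V'"
    and sub: "complex_vs.subspace U" "complex_vs.subspace U'"
      "complex_vs.subspace V" "complex_vs.subspace V'"
    and fE: "bounded_clinear fE" "bounded_clinear gE" "fE ` V' \<subseteq> U'" "gE ` U' \<subseteq> V'"
      "\<And>v. v \<in> V' \<Longrightarrow> gE (fE v) = v" "\<And>v. v \<in> U' \<Longrightarrow> fE (gE v) = v"
    and fF: "bounded_clinear fF" "bounded_clinear gF" "fF ` U \<subseteq> V" "gF ` V \<subseteq> U"
      "\<And>v. v \<in> U \<Longrightarrow> gF (fF v) = v" "\<And>v. v \<in> V \<Longrightarrow> fF (gF v) = v"
  shows "equivalent_via {\<mu>} U U' V V' S T E F"
proof -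
  have lin: "clinear fE" "clinear fF"
    using fE(1) fF(1) by (simp_all add: bounded_clinear_clinear)
  have "S \<mu> \<in> lin_ops U U'"
    unfolding S using fT(4) fE(3)
    by (intro lin_ops_op_on subspace_vimage clinear_compose[OF lin(1)] clinear_compose[OF fT(1)]
        lin sub fT(2)) auto
  moreover have "T \<mu> \<in> lin_ops V V'"
    unfolding T using fT by (intro lin_ops_op_on)
  moreover have "E \<mu> \<in> bdd_ops V' U'" "F \<mu> \<in> bdd_ops U V"
    unfolding E F using fE fF sub by (simp_all add: bdd_ops_op_on)
  moreover have "invertible_op V' U' (E \<mu>)" "invertible_op U V (F \<mu>)"
    unfolding E F by (rule invertible_op_op_on[OF fE(1,2) sub(4,2) fE(3-6)]
        invertible_op_op_on[OF fF(1,2) sub(1,3) fF(3-6)]; assumption)+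
  \<comment> \<open>The product has no smaller domain, since \<open>fT\<close> maps \<open>D\<close>
    into \<open>V'\<close>, where \<open>E\<close> is defined.\<close>
  moreover have "S \<mu> = E \<mu> \<circ>\<^sub>m T \<mu> \<circ>\<^sub>m F \<mu>"
    unfolding S T E F map_comp_op_on using fT(4) by (intro op_on_eqI) auto
  moreover have "dom (S \<mu>) = {v. \<exists>y\<in>dom (T \<mu>). F \<mu> v = Some y}"
    unfolding S T F dom_op_on by (auto simp: op_on_def)
  ultimately show ?thesis by (simp add: equivalent_via_def)
qed

section \<open>Telescoping sums\<close>

lemma sum_lessThan_add:
  "(\<Sum>j<m + k. f j) = (\<Sum>j<m. f j) + (\<Sum>j<k. f (m + j))" for f :: "nat \<Rightarrow> 'a::comm_monoid_add"
  by (induct k) (auto simp: add.assoc)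

text \<open>Evaluates the rows of \<open>N_mat\<close> and the lower rows of \<open>T_mat\<close>.
  Row 0 has no subdiagonal entry, which excludes the truncated index \<open>i - 1\<close>
  there.\<close>

lemma sum_bidiagonal:
  fixes f :: "nat \<Rightarrow> 'a::comm_monoid_add"
  assumes "i < n"
  shows "(\<Sum>j<n. if i = j then f j else if i = Suc j then g j else 0)
    = f i + (if i = 0 then 0 else g (i - 1))"
proof -
  have "(\<Sum>j<n. if i = j then f j else if i = Suc j then g j else 0)
      = (\<Sum>j<n. (if j = i then f j else 0) + (if i \<noteq> 0 \<and> j = i - 1 then g j else 0))"
    by (intro sum.cong) auto
  with assms show ?thesis
    by (cases i) (simp_all add: sum.distrib)
qed

text \<open>Up to sign, \<open>upper_coeff\<close> is the first row of \<open>E_alpha\<close>, and \<open>lower_coeff\<close> is that of \<open>E_beta\<close>.\<close>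

definition upper_coeff ::
  "nat \<Rightarrow> complex \<Rightarrow> (nat \<Rightarrow> 'a \<Rightarrow> 'b::complex_normed_vector) \<Rightarrow> nat \<Rightarrow> 'a \<Rightarrow> 'b"
  where "upper_coeff d \<mu> r j x = (\<Sum>k\<le>j. \<mu> ^ k *\<^sub>C r (d - j + k) x)"

definition lower_coeff ::
  "nat \<Rightarrow> complex \<Rightarrow> (nat \<Rightarrow> 'a \<Rightarrow> 'b::complex_normed_vector) \<Rightarrow> nat \<Rightarrow> 'a \<Rightarrow> 'b"
  where "lower_coeff l \<mu> r j x = (\<Sum>k<l - j. (1 / \<mu> ^ (l - j - k)) *\<^sub>C r k x)"

text \<open>Horner step: split off the summand \<open>k = 0\<close> and take one factor
  \<open>\<mu>\<close> out of the rest.\<close>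

lemma upper_coeff_Suc:
  assumes "Suc j \<le> d"
  shows "upper_coeff d \<mu> r (Suc j) x = r (d - Suc j) x + \<mu> *\<^sub>C upper_coeff d \<mu> r j x"
proof -
  have "d - Suc j + Suc k = d - j + k" for k
    using assms by simp
  then show ?thesis
    by (simp add: upper_coeff_def sum.atMost_Suc_shift complex_vs.scale_sum_right del: sum.atMost_Suc)
qed

text \<open>The factor \<open>\<mu>\<close> raises every negative exponent by one; the last summand
  has exponent -1 and turns into the bare coefficient of index \<open>l - 1 - j\<close>.\<close>

lemma lower_coeff_step:
  assumes "j < l" "\<mu> \<noteq> 0"
  shows "\<mu> *\<^sub>C lower_coeff l \<mu> r j x = lower_coeff l \<mu> r (Suc j) x + r (l - 1 - j) x"
proof -
  obtain n where n: "l - j = Suc n" "l - Suc j = n" "l - 1 - j = n"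
    using assms(1) by (metis Suc_diff_Suc diff_Suc_eq_diff_pred)
  have "\<mu> * (1 / \<mu> ^ (Suc n - k)) = 1 / \<mu> ^ (n - k)" if "k \<le> n" for k
    using that assms(2) by (simp add: Suc_diff_le)
  then show ?thesis
    using assms(2)
    by (simp add: lower_coeff_def n complex_vs.scale_sum_right complex_vs.scale_right_distrib)
qed

lemma lower_coeff_self [simp]: "lower_coeff l \<mu> r l x = 0"
  by (simp add: lower_coeff_def)

lemma clinear_upper_coeff: "(\<And>i. clinear (r i)) \<Longrightarrow> clinear (upper_coeff d \<mu> r j)"
  unfolding upper_coeff_def by (rule clinearI)
    (simp_all add: clinear_simps sum.distrib complex_vs.scale_right_distrib
      complex_vs.scale_sum_right mult.commute)

lemma clinear_lower_coeff: "(\<And>i. clinear (r i)) \<Longrightarrow> clinear (lower_coeff l \<mu> r j)"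
  unfolding lower_coeff_def by (rule clinearI)
    (simp_all add: clinear_simps sum.distrib complex_vs.scale_right_distrib
      complex_vs.scale_sum_right mult.commute)

lemma bounded_clinear_upper_coeff:
  assumes "\<And>k. k \<le> j \<Longrightarrow> bounded_clinear (r (d - j + k))"
  shows "bounded_clinear (upper_coeff d \<mu> r j)"
  unfolding upper_coeff_def using assms by (auto intro!: bounded_clinear_intros)

lemma bounded_clinear_lower_coeff:
  assumes "\<And>k. k < l - j \<Longrightarrow> bounded_clinear (r k)"
  shows "bounded_clinear (lower_coeff l \<mu> r j)"
  unfolding lower_coeff_def using assms by (auto intro!: bounded_clinear_intros)

text \<open>Only indices below \<open>l\<close> enter, where all coefficients are everywhere
  defined.\<close>

lemma op_sum_lower_coeff:
  fixes R :: "nat \<Rightarrow> 'a \<rightharpoonup> 'b::complex_normed_vector"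
  assumes "\<And>i. i < l \<Longrightarrow> R i = op_on UNIV (r i)"
  shows "op_sum (\<lambda>i. (1 / \<mu> ^ (l - j - i)) *\<^sub>o R i) {..<l - j} = op_on UNIV (lower_coeff l \<mu> r j)"
  by (rule trans[OF op_sum_op_on op_on_eqI])
    (auto simp: assms op_scale_op_on lower_coeff_def)

context
  fixes d l :: nat and \<mu> :: complex
    and r :: "nat \<Rightarrow> 'a::complex_normed_vector \<Rightarrow> 'b::complex_normed_vector"
  assumes lin: "\<And>i. clinear (r i)"
begin

text \<open>By the Horner step, the part of summand \<open>n + 1\<close> that acts on
  \<open>z n\<close> cancels the remainder left after summand \<open>n\<close>, up to one
  coefficient applied to \<open>z n\<close>.\<close>

lemma upper_telescope:
  assumes "n < d"
  shows "(\<Sum>j\<le>n. upper_coeff d \<mu> r j ((if j = 0 then 0 else z (j - 1)) - \<mu> *\<^sub>C z j))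
    = (\<Sum>j<n. r (d - 1 - j) (z j)) - \<mu> *\<^sub>C upper_coeff d \<mu> r n (z n)"
  using assms
proof (induct n)
  case 0
  then show ?case by (simp add: clinear_upper_coeff[OF lin] clinear_simps)
next
  case (Suc n)
  then have "upper_coeff d \<mu> r (Suc n) (z n)
      = r (d - 1 - n) (z n) + \<mu> *\<^sub>C upper_coeff d \<mu> r n (z n)"
    by (simp add: upper_coeff_Suc)
  with Suc show ?case by (simp add: clinear_upper_coeff[OF lin] clinear_simps)
qed

text \<open>The step rule turns summand \<open>j\<close> into the difference of consecutive values
  \<open>lower_coeff l \<mu> r j (w j)\<close>, minus one bare coefficient applied to
  \<open>w (Suc j)\<close>.\<close>

lemma lower_telescope:
  assumes "n \<le> l" "\<mu> \<noteq> 0"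
  shows "(\<Sum>j<n. lower_coeff l \<mu> r j (w j - \<mu> *\<^sub>C w (Suc j)))
    = lower_coeff l \<mu> r 0 (w 0) - lower_coeff l \<mu> r n (w n) - (\<Sum>j<n. r (l - 1 - j) (w (Suc j)))"
  using assms(1)
proof (induct n)
  case (Suc n)
  then have "\<mu> *\<^sub>C lower_coeff l \<mu> r n (w (Suc n))
      = lower_coeff l \<mu> r (Suc n) (w (Suc n)) + r (l - 1 - n) (w (Suc n))"
    using assms(2) by (intro lower_coeff_step) auto
  with Suc show ?case
    by (simp add: clinear_lower_coeff[OF lin] clinear_simps)
qed simp

text \<open>The factor \<open>\<mu> ^ l\<close> clears the denominators and leaves the part of the
  polynomial of degree below \<open>l\<close>.\<close>

lemma lower_coeff_0_power:
  assumes "\<mu> \<noteq> 0"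
  shows "lower_coeff l \<mu> r 0 (\<mu> ^ l *\<^sub>C x) = (\<Sum>i<l. \<mu> ^ i *\<^sub>C r i x)"
proof -
  have "1 / \<mu> ^ (l - k) * \<mu> ^ l = \<mu> ^ k" if "k < l" for k
    using that assms by (simp add: power_diff)
  then show ?thesis
    by (simp add: lower_coeff_def lin clinear_simps)
qed

text \<open>Telescoping with \<open>n = l\<close> ends in an empty coefficient sum. For
  \<open>l = 0\<close> all sums are empty, which admits \<open>\<mu> = 0\<close>.\<close>

lemma lower_row_identity:
  assumes "\<mu> \<noteq> 0 \<or> l = 0" and "w 0 = \<mu> ^ l *\<^sub>C x"
  shows "(\<Sum>j<l. lower_coeff l \<mu> r j (w j - \<mu> *\<^sub>C w (Suc j))) + (\<Sum>j<l. r (l - 1 - j) (w (Suc j)))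
    = (\<Sum>i<l. \<mu> ^ i *\<^sub>C r i x)"
  using assms lower_telescope[of l w] lower_coeff_0_power[of x] by (cases "l = 0") auto

text \<open>Serves the first row of the factorization with the coefficients of \<open>P\<close> and
  the last row with those of \<open>Q\<close>. Here \<open>z\<close> stands for the image of a
  vector under \<open>F\<close>, and \<open>u\<close> for the differences produced by
  \<open>T\<close>; the polynomial part of the first row of \<open>T\<close> is left out of
  \<open>u 0\<close> and treated separately.\<close>

lemma row_identity:
  assumes "l < d" "\<mu> \<noteq> 0 \<or> l = 0"
    and z: "z (d - 1 - l) = \<mu> ^ l *\<^sub>C x"
    and u: "\<And>j. j < d \<Longrightarrow> u j = (if j = 0 then 0 else z (j - 1)) - \<mu> *\<^sub>C z j"
  shows "(\<Sum>j<l. lower_coeff l \<mu> r j (u (d - l + j))) + (\<Sum>j<d. r (d - 1 - j) (z j))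
    = (\<Sum>j<d - l. upper_coeff d \<mu> r j (u j)) + (\<Sum>i\<le>d. \<mu> ^ i *\<^sub>C r i x)"
proof -
  \<comment> \<open>Component \<open>n\<close> is where the halves meet: columns up to
    \<open>n\<close> belong to \<open>E_alpha\<close>, the later ones to
    \<open>E_beta\<close>.\<close>
  define n where "n = d - 1 - l"
  have d: "d = Suc (n + l)" using assms(1) by (simp add: n_def)
  have up: "(\<Sum>j<d - l. upper_coeff d \<mu> r j (u j))
      = (\<Sum>j<n. r (d - 1 - j) (z j)) - \<mu> *\<^sub>C upper_coeff d \<mu> r n (z n)"
    using upper_telescope[of n z] by (simp add: d u flip: lessThan_Suc_atMost)
  \<comment> \<open>The remainder of the upper half is exactly the part of the polynomial of degree
    above \<open>l\<close>.\<close>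
  have "\<mu> * (\<mu> ^ k * \<mu> ^ l) = \<mu> ^ (Suc l + k)" for k
    by (simp add: power_add)
  moreover have "upper_coeff d \<mu> r n (z n) = (\<Sum>k\<le>n. (\<mu> ^ k * \<mu> ^ l) *\<^sub>C r (Suc l + k) x)"
    using z by (simp add: upper_coeff_def d lin clinear_simps)
  ultimately have "\<mu> *\<^sub>C upper_coeff d \<mu> r n (z n)
      = (\<Sum>k\<le>n. \<mu> ^ (Suc l + k) *\<^sub>C r (Suc l + k) x)"
    by (simp only: complex_vs.scale_sum_right complex_vs.scale_scale)
  moreover have "(\<Sum>i\<le>d. \<mu> ^ i *\<^sub>C r i x) = (\<Sum>i<l. \<mu> ^ i *\<^sub>C r i x) + \<mu> ^ l *\<^sub>C r l x
      + (\<Sum>k\<le>n. \<mu> ^ (Suc l + k) *\<^sub>C r (Suc l + k) x)"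
    using sum_lessThan_add[of "\<lambda>i. \<mu> ^ i *\<^sub>C r i x" "Suc l" "Suc n"]
    by (simp add: d add.commute flip: lessThan_Suc_atMost)
  moreover have "(\<Sum>j<d. r (d - 1 - j) (z j)) = (\<Sum>j<n. r (d - 1 - j) (z j)) + r l (z n)
      + (\<Sum>j<l. r (l - 1 - j) (z (Suc n + j)))"
    using sum_lessThan_add[of "\<lambda>j. r (d - 1 - j) (z j)" "Suc n" l] by (simp add: d)
  moreover have "r l (z n) = \<mu> ^ l *\<^sub>C r l x"
    using z by (simp add: n_def lin clinear_simps)
  \<comment> \<open>The lower half starts at the meeting component, hence the shift of
    \<open>z\<close> by \<open>n\<close>.\<close>
  moreover have "(\<Sum>j<l. lower_coeff l \<mu> r j (u (d - l + j))) + (\<Sum>j<l. r (l - 1 - j) (z (Suc n + j)))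
      = (\<Sum>i<l. \<mu> ^ i *\<^sub>C r i x)"
    using lower_row_identity[of "\<lambda>j. z (n + j)" x] assms(2) z by (simp add: d u flip: n_def)
  ultimately show ?thesis using up by (simp add: algebra_simps)
qed

end

section \<open>The polynomial and its linearization at a point\<close>

text \<open>The convention \<open>Q\<^sub>d = 0\<close> lets \<open>upper_coeff d \<mu> q\<close> describe the entries of \<open>Et_alpha\<close>,
  whose sums stop one index earlier than those of \<open>E_alpha\<close>.\<close>

locale linearization =
  fixes d l :: nat and \<mu> :: complex
    and P :: "nat \<Rightarrow> 'h::complex_normed_vector \<rightharpoonup> 'h"
    and X :: "complex \<Rightarrow> 'k::complex_normed_vector \<rightharpoonup> 'h"
    and Q :: "nat \<Rightarrow> 'h \<rightharpoonup> 'm::complex_normed_vector"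
    and Z :: "complex \<Rightarrow> 'k \<rightharpoonup> 'm"
    and p :: "nat \<Rightarrow> 'h \<Rightarrow> 'h" and x :: "'k \<Rightarrow> 'h" and q :: "nat \<Rightarrow> 'h \<Rightarrow> 'm" and z :: "'k \<Rightarrow> 'm"
    and pinv :: "'h \<Rightarrow> 'h"
    and Dp Dq :: "'h set" and Dx Dz :: "'k set"
  assumes d_pos: "d \<ge> 1" and l_le: "l \<le> d" and \<mu>: "\<mu> \<noteq> 0 \<or> l = 0"
    and P_eq: "\<And>i. i \<le> d \<Longrightarrow> P i = op_on (if i = l then Dp else UNIV) (p i)"
    and Q_eq: "\<And>i. i < d \<Longrightarrow> Q i = op_on (if i = l then Dq else UNIV) (q i)"
    and X_eq: "X \<mu> = op_on Dx x" and Z_eq: "Z \<mu> = op_on Dz z"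
    and p_lin: "\<And>i. clinear (p i)" and q_lin: "\<And>i. clinear (q i)"
    and x_lin: "clinear x" and z_lin: "clinear z"
    and p_bdd: "\<And>i. i \<le> d \<Longrightarrow> i \<noteq> l \<Longrightarrow> bounded_clinear (p i)"
    and q_bdd: "\<And>i. i \<noteq> l \<Longrightarrow> bounded_clinear (q i)"
    and q_zero: "\<And>i y. i \<ge> d \<Longrightarrow> q i y = 0"
    and Dq_UNIV: "l = d \<Longrightarrow> Dq = UNIV"
    and subspaces: "complex_vs.subspace Dp" "complex_vs.subspace Dq"
      "complex_vs.subspace Dx" "complex_vs.subspace Dz"
    and pinv_eq: "op_inv (P d) = op_on UNIV pinv" and pinv_bdd: "bounded_clinear pinv"
    and p_pinv: "p d (pinv y) = y" and pinv_mem: "l = d \<Longrightarrow> pinv y \<in> Dp"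
    and pinv_p: "l = d \<longrightarrow> y \<in> Dp \<Longrightarrow> pinv (p d y) = y"
begin

lemmas pinv_lin = bounded_clinear_clinear[OF pinv_bdd]

lemmas lin_simps = clinear_simps[OF pinv_lin] clinear_simps[OF p_lin] clinear_simps[OF q_lin]
  clinear_simps[OF x_lin] clinear_simps[OF z_lin]

definition P_fun :: "'h \<Rightarrow> 'h" where "P_fun y = (\<Sum>i\<le>d. \<mu> ^ i *\<^sub>C p i y)"
definition Q_fun :: "'h \<Rightarrow> 'm" where "Q_fun y = (\<Sum>i\<le>d. \<mu> ^ i *\<^sub>C q i y)"

lemma op_poly_P: "op_poly {..d} P \<mu> = op_on Dp P_fun"
proof -
  have "op_poly {..d} P \<mu> = op_on {y. \<forall>i\<in>{..d}. y \<in> (if i = l then Dp else UNIV)}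
      (\<lambda>y. \<Sum>i\<le>d. \<mu> ^ i *\<^sub>C p i y)"
    unfolding op_poly_def by (rule op_sum_op_on) (simp add: P_eq op_scale_op_on)
  also have "\<dots> = op_on Dp P_fun"
    using l_le by (intro op_on_eqI) (auto simp: P_fun_def)
  finally show ?thesis .
qed

lemma Q_fun_eq: "Q_fun y = (\<Sum>i<d. \<mu> ^ i *\<^sub>C q i y)"
  by (simp add: Q_fun_def q_zero flip: lessThan_Suc_atMost)

lemma op_poly_Q: "op_poly {..<d} Q \<mu> = op_on Dq Q_fun"
proof -
  have "op_poly {..<d} Q \<mu> = op_on {y. \<forall>i\<in>{..<d}. y \<in> (if i = l then Dq else UNIV)}
      (\<lambda>y. \<Sum>i<d. \<mu> ^ i *\<^sub>C q i y)"
    unfolding op_poly_def by (rule op_sum_op_on) (simp add: Q_eq op_scale_op_on)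
  \<comment> \<open>For \<open>l = d\<close> the index \<open>l\<close> lies outside the sum, in
    agreement with \<open>Dq = UNIV\<close>.\<close>
  also have "\<dots> = op_on Dq Q_fun"
    using l_le Dq_UNIV by (intro op_on_eqI) (cases "l = d"; auto simp: Q_fun_eq)+
  finally show ?thesis .
qed

text \<open>The rows of \<open>W\<close> applied to \<open>y\<close>. Row \<open>d - 1 - l\<close>
  is the first row of \<open>N_l\<close>, so the subdiagonal begins one row later.\<close>

definition W_fun :: "(nat \<Rightarrow> 'h) \<Rightarrow> nat \<Rightarrow> 'h"
  where "W_fun y i = (if i < d - 1 - l then y i
    else (if i > d - 1 - l then y (i - 1) else 0) - \<mu> *\<^sub>C y i)"

lemma W_entry: "W_mat d l \<mu> i j =
  op_on UNIV (\<lambda>y. if i = j then (if i < d - 1 - l then 1 else - \<mu>) *\<^sub>C y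
    else if i = Suc j then (if d - 1 - l < i then y else 0) else 0)"
proof -
  \<comment> \<open>The block size becomes a variable \<open>k\<close>, which keeps truncated
    subtraction out of the case analysis.\<close>
  have "four_blocks k k id_mat zero_mat zero_mat (N_mat \<mu>) i j =
    op_on UNIV (\<lambda>y. if i = j then (if i < k then 1 else - \<mu>) *\<^sub>C y
      else if i = Suc j then (if k < i then y else 0) else 0)" for k
    by (auto simp: four_blocks_def id_mat_def zero_mat_def N_mat_def scalar_op_op_on
        zero_op_op_on intro!: op_on_eqI)
  then show ?thesis unfolding W_mat_def .
qed

lemma W_sum:
  assumes "i < n"
  shows "(\<Sum>j<n. if i = j then (if i < d - 1 - l then 1 else - \<mu>) *\<^sub>C y j
    else if i = Suc j then (if d - 1 - l < i then y j else 0) else 0) = W_fun y i"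
  by (subst sum_bidiagonal[OF assms]) (auto simp: W_fun_def)

lemma W_op_eq: "W_op d l \<mu> = op_on (power_space (max (d - 1) l))
  (\<lambda>y. seq_of (max (d - 1) l) (W_fun (apply_bcontfun y)))"
  unfolding W_op_def by (subst mat_op_op_on[OF W_entry]) (auto intro!: op_on_eqI seq_of_eqI W_sum)

definition P_ext_fun :: "'h seq \<times> 'k \<Rightarrow> 'h seq \<times> 'm"
  where "P_ext_fun = (\<lambda>(v, y).
    (seq_of (ext_dim d l) (\<lambda>i. if i = 0 then P_fun (apply_bcontfun v 0) + x y
       else W_fun (\<lambda>j. apply_bcontfun v (Suc j)) (i - 1)),
     Q_fun (apply_bcontfun v 0) + z y))"

lemma P_ext_eq: "P_ext d l P X Q Z \<mu> =
  op_on {v \<in> power_space (ext_dim d l) \<times> UNIV. apply_bcontfun (fst v) 0 \<in> Dp \<inter> Dq \<and> snd v \<in> Dx \<inter> Dz}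
    P_ext_fun"
proof -
  let ?n = "ext_dim d l"
  \<comment> \<open>The case distinctions sit inside the value, so that a row is one sum; the
    indices of \<open>W\<close> are shifted by one past the corner.\<close>
  let ?e = "\<lambda>i j y. if i = 0 then (if j = 0 then P_fun y else 0) else if j = 0 then 0 else
    if i - 1 = j - 1 then (if i - 1 < d - 1 - l then 1 else - \<mu>) *\<^sub>C y
    else if i - 1 = Suc (j - 1) then (if d - 1 - l < i - 1 then y else 0) else 0"
  have row: "(\<Sum>j<?n. ?e i j (u j)) =
      (if i = 0 then P_fun (u 0) else W_fun (\<lambda>j. u (Suc j)) (i - 1))" if "i < ?n" for i u
  proof (cases "i = 0")
    case True
    then show ?thesis unfolding ext_dim_def sum.lessThan_Suc_shift by simp
  next
    case False
    then have "i - 1 < max (d - 1) l" using that by (simp add: ext_dim_def)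
    from W_sum[OF this, of "\<lambda>j. u (Suc j)"] show ?thesis
      unfolding ext_dim_def sum.lessThan_Suc_shift
      by (simp only: False if_False if_True diff_Suc_1 nat.simps simp_thms add_0_left)
  qed
  \<comment> \<open>Component 0 exists, so the domain conditions of the corner, the column and the
    row are not vacuous.\<close>
  have n: "0 < ?n" by (simp add: ext_dim_def)
  have A: "mat_op ?n ?n (four_blocks 1 1 (\<lambda>i j. op_poly {..d} P \<mu>) zero_mat zero_mat (W_mat d l \<mu>))
    = op_on {v \<in> power_space ?n. apply_bcontfun v 0 \<in> Dp}
        (\<lambda>v. seq_of ?n (\<lambda>i. if i = 0 then P_fun (apply_bcontfun v 0)
           else W_fun (\<lambda>j. apply_bcontfun v (Suc j)) (i - 1)))"
  proof (rule trans[OF mat_op_op_on op_on_eqI])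
    show "four_blocks 1 1 (\<lambda>i j. op_poly {..d} P \<mu>) zero_mat zero_mat (W_mat d l \<mu>) i j
      = op_on (if i = 0 \<and> j = 0 then Dp else UNIV) (?e i j)" for i j
      by (auto simp: four_blocks_def op_poly_P zero_mat_def zero_op_op_on W_entry intro!: op_on_eqI)
  qed (use n in \<open>force, intro seq_of_eqI row\<close>)
  have B: "col_op ?n (\<lambda>i. if i = 0 then X \<mu> else zero_op)
    = op_on Dx (\<lambda>y. seq_of ?n (\<lambda>i. if i = 0 then x y else 0))"
  proof (rule trans[OF col_op_op_on op_on_eqI])
    show "(if i = 0 then X \<mu> else zero_op)
      = op_on (if i = 0 then Dx else UNIV) (\<lambda>y. if i = 0 then x y else 0)" for i :: nat
      by (simp add: X_eq zero_op_op_on)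
  qed (use n in auto)
  have C: "row_op ?n (\<lambda>j. if j = 0 then op_poly {..<d} Q \<mu> else zero_op)
    = op_on {v \<in> power_space ?n. apply_bcontfun v 0 \<in> Dq} (\<lambda>v. Q_fun (apply_bcontfun v 0))"
  proof (rule trans[OF row_op_op_on op_on_eqI])
    show "(if j = 0 then op_poly {..<d} Q \<mu> else zero_op)
      = op_on (if j = 0 then Dq else UNIV) (\<lambda>y. if j = 0 then Q_fun y else 0)" for j :: nat
      by (simp add: op_poly_Q zero_op_op_on)
  qed (use n in auto)
  show ?thesis
    unfolding P_ext_def A B C Z_eq block_op_op_on
    by (rule op_on_eqI) (auto simp: P_ext_fun_def seq_of_add intro!: seq_of_eqI)
qed

text \<open>Component 0 is coupled only with the outer space and \<open>W\<close> acts only on the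
  tail, on which no domain condition is imposed.\<close>

lemma reorder_P_ext:
  assumes "v \<in> power_space (ext_dim d l) \<times> UNIV"
  shows "map_option reorder (P_ext d l P X Q Z \<mu> v) = op_dsum (P_block d P X Q Z \<mu>) (W_op d l \<mu>) (reorder v)"
proof -
  have "seq_tl (fst v) \<in> power_space (max (d - 1) l)"
    using assms by (auto simp: power_space_def apply_seq_tl ext_dim_def)
  moreover have "seq_tl (seq_of (ext_dim d l) f) = seq_of (max (d - 1) l) (\<lambda>i. f (Suc i))" for f :: "nat \<Rightarrow> 'h"
    by (rule bcontfun_eqI) (simp add: apply_seq_tl apply_seq_of ext_dim_def)
  moreover have "(\<lambda>j. apply_bcontfun u (Suc j)) = apply_bcontfun (seq_tl u)" for u :: "'h seq"
    by (simp add: fun_eq_iff apply_seq_tl)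
  ultimately show ?thesis
    using assms
    unfolding P_block_def op_poly_P op_poly_Q X_eq Z_eq block_op_op_on W_op_eq op_dsum_op_on P_ext_eq
    by (cases v) (auto simp: op_on_def reorder_def P_ext_fun_def apply_seq_of
        ext_dim_def)
qed

definition T_fun :: "'h seq \<times> 'k \<Rightarrow> 'h seq \<times> 'm"
  where "T_fun = (\<lambda>(v, y).
    (seq_of d (\<lambda>i. (if i = 0 then - (\<Sum>j<d. pinv (p (d - 1 - j) (apply_bcontfun v j))) - pinv (x y)
       else apply_bcontfun v (i - 1)) - \<mu> *\<^sub>C apply_bcontfun v i),
     (\<Sum>j<d. q (d - 1 - j) (apply_bcontfun v j)) + z y))"

text \<open>Coefficients of index \<open>l\<close> occur only in column \<open>d - 1 - l\<close>.
  For \<open>l = d\<close> there is no such column.\<close>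

definition T_dom :: "('h seq \<times> 'k) set"
  where "T_dom = {v \<in> power_space d \<times> UNIV.
    (l < d \<longrightarrow> apply_bcontfun (fst v) (d - 1 - l) \<in> Dp \<inter> Dq) \<and> snd v \<in> Dx \<inter> Dz}"

lemma P_hat_eq: "i \<le> d \<Longrightarrow> P_hat d P i = op_on (if i = l then Dp else UNIV) (\<lambda>y. pinv (p i y))"
  unfolding P_hat_def pinv_eq by (simp add: P_eq map_comp_op_on)

lemma T_block_eq: "T_block d P X Q Z \<mu> = op_on T_dom T_fun"
proof -
  let ?D = "\<lambda>j. if d - 1 - j = l then Dp else UNIV"
  let ?e = "\<lambda>i j y. if i = 0 then - pinv (p (d - 1 - j) y) - (if j = 0 then \<mu> *\<^sub>C y else 0)
    else if i = j then - (\<mu> *\<^sub>C y) else if i = Suc j then y else 0"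
  have row: "(\<Sum>j<d. ?e i j (u j)) =
      (if i = 0 then - (\<Sum>j<d. pinv (p (d - 1 - j) (u j))) else u (i - 1)) - \<mu> *\<^sub>C u i" if "i < d" for i u
  proof (cases "i = 0")
    case True
    with that show ?thesis by (simp add: sum_subtractf sum_negf)
  next
    case False
    with sum_bidiagonal[OF that, of "\<lambda>j. - (\<mu> *\<^sub>C u j)" u] show ?thesis by simp
  qed
  have dom: "(\<forall>j<d. u j \<in> (if d - 1 - j = l then D else UNIV)) \<longleftrightarrow> (l < d \<longrightarrow> u (d - 1 - l) \<in> D)"
    for u :: "nat \<Rightarrow> 'e" and D
  proof
    show "l < d \<longrightarrow> u (d - 1 - l) \<in> D" if "\<forall>j<d. u j \<in> (if d - 1 - j = l then D else UNIV)"
      using that[rule_format, of "d - 1 - l"] by auto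
  qed auto
  have A: "mat_op d d (T_mat d P \<mu>)
    = op_on {v \<in> power_space d. l < d \<longrightarrow> apply_bcontfun v (d - 1 - l) \<in> Dp}
        (\<lambda>v. seq_of d (\<lambda>i. (if i = 0 then - (\<Sum>j<d. pinv (p (d - 1 - j) (apply_bcontfun v j)))
           else apply_bcontfun v (i - 1)) - \<mu> *\<^sub>C apply_bcontfun v i))"
  proof (rule trans[OF mat_op_op_on op_on_eqI])
    show "T_mat d P \<mu> i j = op_on (if i = 0 then ?D j else UNIV) (?e i j)" for i j
      by (auto simp: T_mat_def P_hat_eq op_scale_op_on op_plus_op_on
        scalar_op_op_on zero_op_op_on intro!: op_on_eqI)
    \<comment> \<open>Only row 0 restricts the domain, and \<open>d \<ge> 1\<close> guarantees that
      this row is present.\<close>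
    have "(\<forall>i<d. \<forall>j<d. u j \<in> (if i = 0 then ?D j else UNIV)) \<longleftrightarrow> (\<forall>j<d. u j \<in> ?D j)" for u
    proof
      show "\<forall>j<d. u j \<in> ?D j" if "\<forall>i<d. \<forall>j<d. u j \<in> (if i = 0 then ?D j else UNIV)"
        using that[rule_format, of 0] d_pos by simp
    qed simp
    then show "{v \<in> power_space d. \<forall>i<d. \<forall>j<d. apply_bcontfun v j \<in> (if i = 0 then ?D j else UNIV)}
      = {v \<in> power_space d. l < d \<longrightarrow> apply_bcontfun v (d - 1 - l) \<in> Dp}"
      by (simp only: dom)
  qed (intro seq_of_eqI row)
  have B: "col_op d (\<lambda>i. if i = 0 then (-1) *\<^sub>o (op_inv (P d) \<circ>\<^sub>m X \<mu>) else zero_op)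
    = op_on Dx (\<lambda>y. seq_of d (\<lambda>i. if i = 0 then - pinv (x y) else 0))"
  proof (rule trans[OF col_op_op_on op_on_eqI])
    show "(if i = 0 then (-1) *\<^sub>o (op_inv (P d) \<circ>\<^sub>m X \<mu>) else zero_op)
      = op_on (if i = 0 then Dx else UNIV) (\<lambda>y. if i = 0 then - pinv (x y) else 0)" for i :: nat
      unfolding pinv_eq X_eq by (auto simp: map_comp_op_on op_scale_op_on zero_op_op_on)
  qed (use d_pos in auto)
  have C: "row_op d (\<lambda>j. Q (d - 1 - j))
    = op_on {v \<in> power_space d. l < d \<longrightarrow> apply_bcontfun v (d - 1 - l) \<in> Dq}
        (\<lambda>v. \<Sum>j<d. q (d - 1 - j) (apply_bcontfun v j))"
  proof (rule trans[OF row_op_op_on op_on_eqI])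
    show "Q (d - 1 - j) = op_on (if d - 1 - j = l then Dq else UNIV) (q (d - 1 - j))" for j
      using d_pos by (simp add: Q_eq)
    show "{v \<in> power_space d. \<forall>j<d. apply_bcontfun v j \<in> (if d - 1 - j = l then Dq else UNIV)}
      = {v \<in> power_space d. l < d \<longrightarrow> apply_bcontfun v (d - 1 - l) \<in> Dq}"
      by (simp only: dom)
  qed simp
  show ?thesis
    unfolding T_block_def A B C Z_eq block_op_op_on
    by (rule op_on_eqI) (auto simp: T_dom_def T_fun_def seq_of_add intro!: seq_of_eqI)
qed

lemma T_fun_lin: "clinear T_fun"
proof (rule clinearI)
  show "T_fun (v + w) = T_fun v + T_fun w" for v w
    by (auto simp: T_fun_def case_prod_unfold seq_of_add lin_simps sum.distrib scaleC_add_right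
        intro!: seq_of_eqI)
  have scale: "c *\<^sub>C seq_of m f = seq_of m (\<lambda>i. c *\<^sub>C f i)" for c m and f :: "nat \<Rightarrow> 'h"
    by (rule bcontfun_eqI) (simp add: apply_scaleC_bcontfun apply_seq_of)
  show "T_fun (c *\<^sub>C v) = c *\<^sub>C T_fun v" for c v
    by (auto simp: T_fun_def case_prod_unfold scaleC_prod_def scale apply_scaleC_bcontfun lin_simps
        complex_vs.scale_sum_right complex_vs.scale_right_diff_distrib scaleC_add_right mult.commute
        intro!: seq_of_eqI)
qed

lemma T_dom_subspace: "complex_vs.subspace T_dom"
  using subspaces subspace_power_space[of d]
  by (auto simp: complex_vs.subspace_def T_dom_def apply_scaleC_bcontfun scaleC_prod_def
      zero_prod_def)

lemma T_dom_subset: "T_dom \<subseteq> power_space d \<times> UNIV"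
  by (auto simp: T_dom_def)

lemma T_fun_mem: "T_fun v \<in> power_space d \<times> UNIV"
  by (simp add: T_fun_def case_prod_unfold seq_of_in_power_space)

end

section \<open>The case of an unbounded coefficient below the leading one\<close>

text \<open>Horner step for the rows of \<open>E_alpha\<close> below the first, which carry the
  powers of \<open>\<mu>\<close> on and above the diagonal.\<close>

lemma weighted_sum_Suc:
  fixes f :: "nat \<Rightarrow> 'a::complex_normed_vector"
  assumes "i < m"
  shows "(\<Sum>j\<in>{i..<m}. \<mu> ^ (j - i) *\<^sub>C f j)
    = f i + \<mu> *\<^sub>C (\<Sum>j\<in>{Suc i..<m}. \<mu> ^ (j - Suc i) *\<^sub>C f j)"
proof -
  have "\<mu> ^ (j - i) = \<mu> * \<mu> ^ (j - Suc i)" if "Suc i \<le> j" for j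
    using that by (metis Suc_diff_le diff_Suc_Suc power_Suc)
  then show ?thesis
    using assms by (simp add: sum.atLeast_Suc_lessThan complex_vs.scale_sum_right)
qed

text \<open>The triangular matrix of these powers is a finite Neumann series: it inverts the
  identity minus \<open>\<mu>\<close> times the superdiagonal shift. Induction runs downwards from
  \<open>k\<close>, where the shift is cut off.\<close>

lemma weighted_sum_inverse:
  fixes t :: "nat \<Rightarrow> 'a::complex_normed_vector"
  assumes "i \<le> k"
  shows "(\<Sum>j\<in>{i..<Suc k}. \<mu> ^ (j - i) *\<^sub>C (t j - (if j < k then \<mu> *\<^sub>C t (Suc j) else 0))) = t i"
  using assms
proof (induct rule: inc_induct)
  case base
  show ?case by simp
next
  case (step i)
  then show ?case by (subst weighted_sum_Suc) auto
qed

text \<open>With \<open>k = d - 1 - l\<close> the columns of \<open>E_alpha\<close> are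
  \<open>0\<close> to \<open>k\<close>. The component spaces \<open>'h\<close>, \<open>'k\<close>,
  \<open>'m\<close> appear below as \<open>'a\<close>, \<open>'b\<close>, \<open>'c\<close>.\<close>

locale linearization_low = linearization +
  fixes k :: nat
  assumes d_Suc: "d = Suc (k + l)"
begin

lemma d_eq: "d = Suc (k + l)" "d - l = Suc k" "d - Suc l = k"
  using d_Suc by auto

lemma d_simps: "d - l = Suc k" "d - Suc l = k" "d - Suc k = l" "d - k = Suc l" "Suc (k + j) < d \<longleftrightarrow> j < l"
  using d_Suc by auto

lemma l_less: "l < d"
  using d_Suc by simp

lemma ext_dim_low: "ext_dim d l = d"
  using l_less by (simp add: ext_dim_def)

lemma k_less: "k < d"
  by (simp add: d_eq(1))

text \<open>For \<open>j \<le> k\<close> only indices from \<open>l + 1\<close> to \<open>d\<close>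
  occur, which avoids the possibly unbounded coefficient.\<close>

lemma upper_p_bdd: "j \<le> k \<Longrightarrow> bounded_clinear (upper_coeff d \<mu> p j)"
  by (rule bounded_clinear_upper_coeff) (auto intro!: p_bdd simp: d_eq(1))

lemma lower_p_bdd: "bounded_clinear (lower_coeff l \<mu> p j)"
  by (rule bounded_clinear_lower_coeff) (auto intro!: p_bdd simp: d_eq(1))

lemma upper_q_bdd: "j \<le> k \<Longrightarrow> bounded_clinear (upper_coeff d \<mu> q j)"
  by (rule bounded_clinear_upper_coeff) (auto intro!: q_bdd simp: d_eq(1))

lemma lower_q_bdd: "bounded_clinear (lower_coeff l \<mu> q j)"
  by (rule bounded_clinear_lower_coeff) (auto intro!: q_bdd)

lemmas bdd_intros = bounded_clinear_intros
  upper_p_bdd[THEN bounded_clinear_compose] lower_p_bdd[THEN bounded_clinear_compose]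
  upper_q_bdd[THEN bounded_clinear_compose] lower_q_bdd[THEN bounded_clinear_compose]
  pinv_bdd[THEN bounded_clinear_compose]

section \<open>Explicit transformations and their inverses for l < d\<close>

definition E_fun :: "'a seq \<times> 'c \<Rightarrow> 'a seq \<times> 'c"
  where "E_fun v =
    (seq_of d (\<lambda>i. if i = 0 then
         (\<Sum>j<l. lower_coeff l \<mu> p j (apply_bcontfun (fst v) (d - l + j)))
         - (\<Sum>j<Suc k. upper_coeff d \<mu> p j (apply_bcontfun (fst v) j))
       else if i \<le> k then \<Sum>j\<in>{i..<Suc k}. \<mu> ^ (j - i) *\<^sub>C apply_bcontfun (fst v) j
       else apply_bcontfun (fst v) i),
     (\<Sum>j<l. lower_coeff l \<mu> q j (apply_bcontfun (fst v) (d - l + j)))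
     - (\<Sum>j<Suc k. upper_coeff d \<mu> q j (apply_bcontfun (fst v) j)) + snd v)"

text \<open>Below row 0 the inverse of \<open>E_alpha\<close> is bidiagonal; past index
  \<open>k\<close> the entry is that of the identity.\<close>

definition E_inv_entry :: "(nat \<Rightarrow> 'a) \<Rightarrow> nat \<Rightarrow> 'a"
  where "E_inv_entry t i = t i - (if i < k then \<mu> *\<^sub>C t (Suc i) else 0)"

text \<open>Block triangular elimination: the components from 1 on are known first, the first row is
  then solved for component 0 through its entry \<open>-P_d\<close>, and the last component
  follows.\<close>

definition E_inv :: "'a seq \<times> 'c \<Rightarrow> 'a seq \<times> 'c"
  where "E_inv v =
    (seq_of d (\<lambda>i. if i = 0 then
         pinv ((\<Sum>j<l. lower_coeff l \<mu> p j (apply_bcontfun (fst v) (d - l + j)))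
           - (\<Sum>j<k. upper_coeff d \<mu> p (Suc j) (E_inv_entry (apply_bcontfun (fst v)) (Suc j)))
           - apply_bcontfun (fst v) 0)
       else E_inv_entry (apply_bcontfun (fst v)) i),
     snd v - (\<Sum>j<l. lower_coeff l \<mu> q j (apply_bcontfun (fst v) (d - l + j)))
     + (\<Sum>j<k. upper_coeff d \<mu> q (Suc j) (E_inv_entry (apply_bcontfun (fst v)) (Suc j))))"

text \<open>Component \<open>k\<close> comes from the bottom row of \<open>F_alpha\<close> and has
  no second summand. The exponent \<open>d - 1 - i\<close> also covers \<open>F_beta\<close>, whose
  rows are shifted by \<open>Suc k\<close>.\<close>

definition F_fun :: "'a seq \<times> 'b \<Rightarrow> 'a seq \<times> 'b"
  where "F_fun v =
    (seq_of d (\<lambda>i. \<mu> ^ (d - 1 - i) *\<^sub>C apply_bcontfun (fst v) 0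
       + (if i < k then apply_bcontfun (fst v) (Suc i) else if i = k then 0 else apply_bcontfun (fst v) i)),
     snd v)"

text \<open>Component 0 is read off from component \<open>k\<close>, which is
  \<open>\<mu> ^ l\<close> times it; the index \<open>i - 1\<close> undoes the cyclic shift of
  rows.\<close>

definition F_inv :: "'a seq \<times> 'b \<Rightarrow> 'a seq \<times> 'b"
  where "F_inv v =
    (seq_of d (\<lambda>i. if i = 0 then (1 / \<mu> ^ l) *\<^sub>C apply_bcontfun (fst v) k
       else if i \<le> k then apply_bcontfun (fst v) (i - 1)
         - (\<mu> ^ (d - i) / \<mu> ^ l) *\<^sub>C apply_bcontfun (fst v) k
       else apply_bcontfun (fst v) i - (\<mu> ^ (d - 1 - i) / \<mu> ^ l) *\<^sub>C apply_bcontfun (fst v) k),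
     snd v)"

lemma bounded_transformations:
  "bounded_clinear E_fun" "bounded_clinear E_inv" "bounded_clinear F_fun" "bounded_clinear F_inv"
proof -
  show "bounded_clinear E_fun" unfolding E_fun_def
    by (intro bdd_intros) auto
  show "bounded_clinear E_inv" unfolding E_inv_def E_inv_entry_def
    by (intro bdd_intros) auto
  show "bounded_clinear F_fun" unfolding F_fun_def
    by (intro bdd_intros)
  show "bounded_clinear F_inv" unfolding F_inv_def
    by (intro bdd_intros)
qed

lemma upper_0: "upper_coeff d \<mu> p 0 y = p d y" "upper_coeff d \<mu> q 0 y = 0"
  by (simp_all add: upper_coeff_def q_zero)

lemma pinv_p_low: "pinv (p d y) = y"
  using l_less by (intro pinv_p) simp

lemma E_inv_E:
  assumes "v \<in> power_space d \<times> UNIV"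
  shows "E_inv (E_fun v) = v"
proof -
  obtain u s where v: "v = (u, s)" by (cases v)
  have tail: "apply_bcontfun (fst (E_fun v)) (d - l + j) = apply_bcontfun u (d - l + j)" if "j < l" for j
    using that by (simp add: E_fun_def v apply_seq_of d_simps)
  have entry: "E_inv_entry (apply_bcontfun (fst (E_fun v))) i = apply_bcontfun u i"
    if "0 < i" "i < d" for i
    using that k_less weighted_sum_Suc[of i "Suc k" \<mu> "apply_bcontfun u"]
    by (cases i k rule: linorder_cases)
      (auto simp: E_inv_entry_def E_fun_def v apply_seq_of simp del: sum.op_ivl_Suc)
  have head: "apply_bcontfun (fst (E_fun v)) 0 =
      (\<Sum>j<l. lower_coeff l \<mu> p j (apply_bcontfun u (d - l + j)))
      - (p d (apply_bcontfun u 0) + (\<Sum>j<k. upper_coeff d \<mu> p (Suc j) (apply_bcontfun u (Suc j))))"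
    using d_pos by (simp add: E_fun_def v apply_seq_of sum.lessThan_Suc_shift upper_0 del: sum.lessThan_Suc)
  have s: "snd (E_fun v) = (\<Sum>j<l. lower_coeff l \<mu> q j (apply_bcontfun u (d - l + j)))
      - (\<Sum>j<k. upper_coeff d \<mu> q (Suc j) (apply_bcontfun u (Suc j))) + s"
    by (simp add: E_fun_def v sum.lessThan_Suc_shift upper_0 del: sum.lessThan_Suc)
  have "E_inv (E_fun v) = (seq_of d (apply_bcontfun u), s)"
    unfolding E_inv_def using k_less
    by (auto simp: tail entry head s pinv_p_low intro!: seq_of_eqI)
  with assms show ?thesis by (simp add: v seq_of_apply)
qed

lemma E_E_inv:
  assumes "v \<in> power_space d \<times> UNIV"
  shows "E_fun (E_inv v) = v"
proof -
  obtain t s where v: "v = (t, s)" by (cases v)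
  let ?t = "apply_bcontfun t"
  have tail: "apply_bcontfun (fst (E_inv v)) (d - l + j) = ?t (d - l + j)" if "j < l" for j
    using that by (simp add: E_inv_def E_inv_entry_def v apply_seq_of d_simps)
  have entry: "apply_bcontfun (fst (E_inv v)) i = E_inv_entry ?t i" if "0 < i" "i < d" for i
    using that by (simp add: E_inv_def v apply_seq_of)
  have head: "p d (apply_bcontfun (fst (E_inv v)) 0) =
      (\<Sum>j<l. lower_coeff l \<mu> p j (?t (d - l + j)))
      - (\<Sum>j<k. upper_coeff d \<mu> p (Suc j) (E_inv_entry ?t (Suc j))) - ?t 0"
    using d_pos by (simp add: E_inv_def v apply_seq_of p_pinv)
  have s: "snd (E_inv v) = s - (\<Sum>j<l. lower_coeff l \<mu> q j (?t (d - l + j)))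
      + (\<Sum>j<k. upper_coeff d \<mu> q (Suc j) (E_inv_entry ?t (Suc j)))"
    by (simp add: E_inv_def v)
  have middle: "(\<Sum>j\<in>{i..<Suc k}. \<mu> ^ (j - i) *\<^sub>C apply_bcontfun (fst (E_inv v)) j) = ?t i"
    if "0 < i" "i \<le> k" for i
  proof -
    have "(\<Sum>j\<in>{i..<Suc k}. \<mu> ^ (j - i) *\<^sub>C apply_bcontfun (fst (E_inv v)) j)
        = (\<Sum>j\<in>{i..<Suc k}. \<mu> ^ (j - i) *\<^sub>C E_inv_entry ?t j)"
      using that k_less by (intro sum.cong) (auto simp: entry)
    also have "\<dots> = ?t i"
      unfolding E_inv_entry_def by (rule weighted_sum_inverse) (fact that(2))
    finally show ?thesis .
  qed
  have "E_fun (E_inv v) = (seq_of d ?t, s)"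
    unfolding E_fun_def sum.lessThan_Suc_shift upper_0 using k_less
    by (auto simp: tail entry head s middle E_inv_entry_def weighted_sum_inverse intro!: seq_of_eqI
        simp del: sum.op_ivl_Suc)
  with assms show ?thesis by (simp add: v seq_of_apply)
qed

lemma \<mu>_power: "\<mu> ^ l \<noteq> 0"
  using \<mu> by auto

lemma F_inv_F:
  assumes "v \<in> power_space d \<times> UNIV"
  shows "F_inv (F_fun v) = v"
proof -
  obtain u s where v: "v = (u, s)" by (cases v)
  have "d - 1 - (i - 1) = d - i" if "0 < i" for i using that by simp
  then have "F_inv (F_fun v) = (seq_of d (apply_bcontfun u), s)"
    using \<mu>_power k_less
    by (auto simp: F_inv_def F_fun_def v apply_seq_of d_simps intro!: seq_of_eqI)
  with assms show ?thesis by (simp add: v seq_of_apply)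
qed

lemma F_F_inv:
  assumes "v \<in> power_space d \<times> UNIV"
  shows "F_fun (F_inv v) = v"
proof -
  obtain u s where v: "v = (u, s)" by (cases v)
  have "F_fun (F_inv v) = (seq_of d (apply_bcontfun u), s)"
    using \<mu>_power k_less
    by (auto simp: F_inv_def F_fun_def v apply_seq_of d_simps intro!: seq_of_eqI)
  with assms show ?thesis by (simp add: v seq_of_apply)
qed

section \<open>The factorization for l < d\<close>

lemma P_ext_factorization: "P_ext_fun v = E_fun (T_fun (F_fun v))"
proof -
  obtain u y where v: "v = (u, y)" by (cases v)
  define w where "w = apply_bcontfun (fst (F_fun v))"
  define t where "t = apply_bcontfun (fst (T_fun (F_fun v)))"
  \<comment> \<open>\<open>e\<close> collects the part of the first component of \<open>T\<close>
    apart from \<open>-\<mu>\<close> times \<open>w 0\<close>. Dropping it in \<open>t'\<close>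
    leaves pure differences, as \<open>row_identity\<close> demands.\<close>
  define e where "e = - (\<Sum>j<d. pinv (p (d - 1 - j) (w j))) - pinv (x y)"
  define t' where "t' = (\<lambda>i. if i = 0 then - (\<mu> *\<^sub>C w 0) else t i)"
  have wk: "w (d - 1 - l) = \<mu> ^ l *\<^sub>C apply_bcontfun u 0"
    using k_less by (simp add: w_def F_fun_def v apply_seq_of d_simps)
  have t: "t i = (if i = 0 then e else w (i - 1)) - \<mu> *\<^sub>C w i" if "i < d" for i
    using that unfolding t_def T_fun_def by (simp add: case_prod_unfold F_fun_def v apply_seq_of w_def e_def)
  then have t': "t' i = (if i = 0 then 0 else w (i - 1)) - \<mu> *\<^sub>C w i" if "i < d" for i
    using that by (simp add: t'_def)
  have snd_T: "snd (T_fun (F_fun v)) = (\<Sum>j<d. q (d - 1 - j) (w j)) + z y"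
    by (simp add: T_fun_def case_prod_unfold w_def F_fun_def v)
  have tail: "t' (d - l + j) = t (d - l + j)" for j
    by (simp add: t'_def d_simps)
  \<comment> \<open>Column 0 of the upper coefficients is \<open>r d\<close>, so restoring
    \<open>e\<close> costs exactly \<open>r d e\<close>.\<close>
  have upper: "(\<Sum>j<Suc k. upper_coeff d \<mu> r j (t j))
      = (\<Sum>j<d - l. upper_coeff d \<mu> r j (t' j)) + r d e" if r: "\<And>i. clinear (r i)"
    for r :: "nat \<Rightarrow> 'a \<Rightarrow> 'e::complex_normed_vector"
  proof -
    have "r d (t 0) = r d e - \<mu> *\<^sub>C r d (w 0)"
      using t[of 0] d_pos by (simp add: clinear_simps[OF r])
    then show ?thesis
      unfolding d_simps(1) sum.lessThan_Suc_shift
      by (simp add: t'_def upper_coeff_def clinear_simps[OF r])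
  qed
  \<comment> \<open>For \<open>r = p\<close> the term \<open>p d e\<close> cancels the sum over
    \<open>w\<close> and leaves \<open>x y\<close>. For \<open>r = q\<close> it is zero, and the sum
    over \<open>w\<close> cancels against the last row of \<open>T\<close>.\<close>
  have row: "(\<Sum>j<l. lower_coeff l \<mu> r j (t (d - l + j))) - (\<Sum>j<Suc k. upper_coeff d \<mu> r j (t j))
      = (\<Sum>i\<le>d. \<mu> ^ i *\<^sub>C r i (apply_bcontfun u 0)) - (\<Sum>j<d. r (d - 1 - j) (w j)) - r d e"
    if r: "\<And>i. clinear (r i)" for r :: "nat \<Rightarrow> 'a \<Rightarrow> 'e::complex_normed_vector"
    using row_identity[where r = r, OF r l_less \<mu> wk t', unfolded tail] upper[of r, OF r] by (simp add: algebra_simps)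
  have pe: "p d e = - (\<Sum>j<d. p (d - 1 - j) (w j)) - x y"
    by (simp add: e_def lin_simps p_pinv)
  \<comment> \<open>Consecutive components of \<open>w\<close> carry consecutive powers of
    \<open>\<mu>\<close> in front of component 0 of \<open>u\<close>, so these multiples cancel in
    the differences. The weighted sum then undoes the remaining shift.\<close>
  have middle: "(\<Sum>j\<in>{i..<Suc k}. \<mu> ^ (j - i) *\<^sub>C t j) = apply_bcontfun u i" if i: "0 < i" "i \<le> k" for i
    using i(2,1)
  proof (induct rule: inc_induct)
    case base
    then show ?case
      using k_less wk by (auto simp: t w_def F_fun_def v apply_seq_of d_simps)
  next
    case (step i)
    then have "i - 1 < k" by linarith
    then have "w i = \<mu> ^ (d - 1 - i) *\<^sub>C apply_bcontfun u 0 + apply_bcontfun u (Suc i)"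
      "w (i - 1) = \<mu> ^ (d - i) *\<^sub>C apply_bcontfun u 0 + apply_bcontfun u i"
      using step k_less by (simp_all add: w_def F_fun_def v apply_seq_of)
    moreover have "\<mu> ^ (d - i) = \<mu> * \<mu> ^ (d - 1 - i)"
      using step k_less by (metis Suc_diff_Suc diff_Suc_eq_diff_pred order_less_trans power_Suc)
    ultimately show ?case
      using step k_less by (subst weighted_sum_Suc) (auto simp: t scaleC_add_right)
  qed
  \<comment> \<open>At \<open>i = Suc k\<close> the predecessor \<open>w k\<close> is a multiple of
    component 0 alone; this gives the first row of \<open>N_l\<close>, without subdiagonal.\<close>
  have last: "t i = W_fun (\<lambda>j. apply_bcontfun u (Suc j)) (i - 1)" if "k < i" "i < d" for i
  proof (cases "i = Suc k")
    case True
    have "\<mu> ^ l = \<mu> * \<mu> ^ (d - 1 - i)"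
      using that d_Suc by (cases l) (auto simp: True)
    with that k_less show ?thesis
      by (simp add: True t W_fun_def w_def F_fun_def v apply_seq_of d_simps scaleC_add_right scaleC_scaleC)
  next
    case False
    then have "\<mu> ^ (d - i) = \<mu> * \<mu> ^ (d - 1 - i)"
      using that by (metis Suc_diff_Suc diff_Suc_eq_diff_pred power_Suc)
    moreover have "d - 1 - (i - 1) = d - i" "Suc (i - Suc (Suc 0)) = i - Suc 0"
      using that False by simp_all
    ultimately show ?thesis
      using False that k_less
      by (auto simp: t W_fun_def w_def F_fun_def v apply_seq_of d_simps scaleC_add_right scaleC_scaleC)
  qed
  have "E_fun (T_fun (F_fun v)) = (seq_of d (\<lambda>i. if i = 0 then P_fun (apply_bcontfun u 0) + x y
      else if i \<le> k then apply_bcontfun u i else t i), Q_fun (apply_bcontfun u 0) + z y)"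
    unfolding E_fun_def t_def[symmetric] row[of p, OF p_lin] row[of q, OF q_lin] snd_T
    by (auto simp: pe P_fun_def Q_fun_def q_zero middle intro!: seq_of_eqI simp del: sum.op_ivl_Suc)
  also have "\<dots> = P_ext_fun v"
    by (auto simp: P_ext_fun_def v ext_dim_low last W_fun_def d_simps intro!: seq_of_eqI)
  finally show ?thesis ..
qed

section \<open>Identification with the block matrices for l < d\<close>

lemma sum_blocks:
  "(\<Sum>j<d. if j \<le> k then f j else g j) = (\<Sum>j<Suc k. f j) + (\<Sum>j<l. g (d - l + j))"
  for f :: "nat \<Rightarrow> 'e::comm_monoid_add"
proof -
  have d: "d = Suc k + l" using d_Suc by simp
  show ?thesis
    unfolding d sum_lessThan_add by (intro arg_cong2[where f = plus] sum.cong) auto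
qed

lemma E_block_eq: "E_block d l P Q \<mu> = op_on (power_space d \<times> UNIV) E_fun"
proof -
  let ?e = "\<lambda>i j y. if i = 0 then (if j \<le> k then - upper_coeff d \<mu> p j y
      else lower_coeff l \<mu> p (j - Suc k) y)
    else if i \<le> k then (if i \<le> j \<and> j \<le> k then \<mu> ^ (j - i) *\<^sub>C y else 0)
    else if i = j then y else 0"
  have E_entry: "E_mat d l P \<mu> i j = op_on UNIV (?e i j)" if ij: "i < d" "j < d" for i j
  proof -
    \<comment> \<open>The bound \<open>j \<le> k\<close> keeps the index \<open>l\<close> out of the
      sum, hence the full domain.\<close>
    have alpha: "E_alpha d P \<mu> i j = op_on UNIV (if i = 0 then \<lambda>y. - upper_coeff d \<mu> p j y
        else if i \<le> j then \<lambda>y. \<mu> ^ (j - i) *\<^sub>C y else (\<lambda>y. 0))" if "j \<le> k"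
    proof -
      have "op_sum (\<lambda>i. \<mu> ^ i *\<^sub>o P (d - j + i)) {..j} = op_on UNIV (upper_coeff d \<mu> p j)"
        by (rule trans[OF op_sum_op_on op_on_eqI])
          (use that d_Suc in \<open>auto simp: P_eq op_scale_op_on upper_coeff_def\<close>)
      then show ?thesis
        by (simp add: E_alpha_def op_scale_op_on scalar_op_op_on zero_op_op_on)
    qed
    have beta: "E_beta l P \<mu> i j = op_on UNIV (if i = 0 then lower_coeff l \<mu> p j else (\<lambda>y. 0))" for j
      using op_sum_lower_coeff[of l P p \<mu> j] l_le by (simp add: E_beta_def P_eq zero_op_op_on)
    consider "j \<le> k" | "j > k" "l \<noteq> 0" using ij d_Suc by linarith
    moreover have "i \<le> k" if "l = 0" using that ij d_Suc by simp
    ultimately show ?thesis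
      using l_less by cases (auto simp: E_mat_def four_blocks_def alpha beta d_simps less_Suc_eq_le
          zero_mat_def id_mat_def scalar_op_op_on zero_op_op_on intro!: op_on_eqI)
  qed
  have E_row: "(\<Sum>j<d. ?e i j (u j)) = (if i = 0 then
      (\<Sum>j<l. lower_coeff l \<mu> p j (u (d - l + j))) - (\<Sum>j<Suc k. upper_coeff d \<mu> p j (u j))
      else if i \<le> k then \<Sum>j\<in>{i..<Suc k}. \<mu> ^ (j - i) *\<^sub>C u j else u i)" if "i < d" for i u
  proof -
    have "(\<Sum>j<d. if i \<le> j \<and> j \<le> k then \<mu> ^ (j - i) *\<^sub>C u j else 0)
      = (\<Sum>j\<in>{i..<Suc k}. \<mu> ^ (j - i) *\<^sub>C u j)"
      using k_less by (intro sum.mono_neutral_cong_right) auto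
    moreover have "(\<Sum>j<d. if j \<le> k then - upper_coeff d \<mu> p j (u j) else lower_coeff l \<mu> p (j - Suc k) (u j))
      = (\<Sum>j<l. lower_coeff l \<mu> p j (u (d - l + j))) - (\<Sum>j<Suc k. upper_coeff d \<mu> p j (u j))"
      unfolding sum_blocks by (simp add: d_simps sum_negf)
    ultimately show ?thesis using that by simp
  qed
  let ?r = "\<lambda>j y. if j \<le> k then - upper_coeff d \<mu> q j y else lower_coeff l \<mu> q (j - Suc k) y"
  have Et_entry: "Et_row d l P Q \<mu> j = op_on UNIV (?r j)" if "j < d" for j
  proof -
    have "Et_alpha d Q \<mu> j = op_on UNIV (\<lambda>y. - upper_coeff d \<mu> q j y)" if "j \<le> k"
    proof -
      have "op_sum (\<lambda>i. \<mu> ^ i *\<^sub>o Q (d - j + i)) {..<j} = op_on UNIV (upper_coeff d \<mu> q j)"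
      proof (rule trans[OF op_sum_op_on op_on_eqI])
        show "\<mu> ^ i *\<^sub>o Q (d - j + i) = op_on UNIV (\<lambda>y. \<mu> ^ i *\<^sub>C q (d - j + i) y)" if "i \<in> {..<j}" for i
        proof -
          have "d - j + i < d" "d - j + i \<noteq> l" using that \<open>j \<le> k\<close> d_Suc by auto
          then show ?thesis by (simp add: Q_eq op_scale_op_on)
        qed
        \<comment> \<open>The extra summand of \<open>upper_coeff\<close> has index
          \<open>d\<close>, where \<open>q\<close> vanishes.\<close>
        show "(\<Sum>i<j. \<mu> ^ i *\<^sub>C q (d - j + i) y) = upper_coeff d \<mu> q j y" for y
          using that k_less by (simp add: upper_coeff_def q_zero flip: lessThan_Suc_atMost)
      qed simp
      then show ?thesis
        by (auto simp: Et_alpha_def op_scale_op_on zero_op_op_on upper_0 intro!: op_on_eqI)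
    qed
    moreover have "Et_beta l Q \<mu> j = op_on UNIV (lower_coeff l \<mu> q j)" for j
      using op_sum_lower_coeff[of l Q q \<mu> j] l_less by (simp add: Et_beta_def Q_eq)
    ultimately show ?thesis
      using that d_Suc by (auto simp: Et_row_def d_simps intro!: op_on_eqI)
  qed
  have Et_row: "(\<Sum>j<d. ?r j (u j))
      = (\<Sum>j<l. lower_coeff l \<mu> q j (u (d - l + j))) - (\<Sum>j<Suc k. upper_coeff d \<mu> q j (u j))" for u
    unfolding sum_blocks by (simp add: d_simps sum_negf)
  \<comment> \<open>Putting 0 into the second component isolates the first block column of
    \<open>E_fun\<close>.\<close>
  have "mat_op d d (E_mat d l P \<mu>) = op_on (power_space d) (\<lambda>v. fst (E_fun (v, 0)))"
    by (rule trans[OF mat_op_op_on op_on_eqI], erule (1) E_entry)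
      (auto simp: E_fun_def E_row simp del: sum.op_ivl_Suc sum.lessThan_Suc intro!: seq_of_eqI)
  moreover have "row_op d (Et_row d l P Q \<mu>) = op_on (power_space d) (\<lambda>v. snd (E_fun (v, 0)))"
    by (rule trans[OF row_op_op_on op_on_eqI], erule Et_entry)
      (auto simp: E_fun_def Et_row simp del: sum.lessThan_Suc)
  ultimately show ?thesis
    unfolding E_block_def ext_dim_low scalar_op_op_on zero_op_op_on
    by (auto simp: block_op_op_on E_fun_def intro!: op_on_eqI seq_of_eqI)
qed

lemma transformations_mem:
  "E_fun v \<in> power_space d \<times> UNIV" "E_inv v \<in> power_space d \<times> UNIV"
  "F_fun w \<in> power_space d \<times> UNIV" "F_inv w \<in> power_space d \<times> UNIV"
  by (simp_all add: E_fun_def E_inv_def F_fun_def F_inv_def seq_of_in_power_space)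

lemma F_block_eq: "F_block d l P X \<mu> = op_on (power_space d \<times> UNIV) F_fun"
proof -
  let ?e = "\<lambda>i j y. if j = 0 then \<mu> ^ (d - 1 - i) *\<^sub>C y
    else if i < k \<and> j = Suc i \<or> k < i \<and> i = j then y else 0"
  have entry: "F_mat d l P \<mu> i j = op_on UNIV (?e i j)" if "i < d" "j < d" for i j
  proof (cases "l = 0")
    case True
    with that d_Suc show ?thesis
      by (auto simp: F_mat_def F_alpha_def scalar_op_op_on zero_op_op_on intro!: op_on_eqI)
  next
    case False
    have "l - 1 - (i - Suc k) = d - 1 - i" if "i > k" using that d_Suc by simp
    with False that d_Suc show ?thesis
      by (auto simp: F_mat_def F_alpha_def F_beta_def four_blocks_def d_simps zero_mat_def id_mat_def
          scalar_op_op_on zero_op_op_on intro!: op_on_eqI)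
  qed
  have row: "(\<Sum>j<d. ?e i j (u j)) = \<mu> ^ (d - 1 - i) *\<^sub>C u 0
      + (if i < k then u (Suc i) else if i = k then 0 else u i)" if "i < d" for i u
  proof -
    have "(\<Sum>j<d. ?e i j (u j)) = (\<Sum>j<d. (if j = 0 then \<mu> ^ (d - 1 - i) *\<^sub>C u j else 0)
      + (if i < k then if j = Suc i then u j else 0 else if k < i then if j = i then u j else 0 else 0))"
      by (intro sum.cong) auto
    also have "\<dots> = \<mu> ^ (d - 1 - i) *\<^sub>C u 0
      + (if i < k then u (Suc i) else if i = k then 0 else u i)"
      using that k_less by (auto simp: sum.distrib)
    finally show ?thesis .
  qed
  have "mat_op d d (F_mat d l P \<mu>) = op_on (power_space d) (\<lambda>v. fst (F_fun (v, 0)))"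
    by (rule trans[OF mat_op_op_on op_on_eqI], erule (1) entry)
      (auto simp: F_fun_def row intro!: seq_of_eqI)
  moreover have "col_op d (Ft_col d l P X \<mu>) = op_on UNIV (\<lambda>y. 0)"
    by (rule trans[OF col_op_op_on[of _ _ "\<lambda>i. UNIV" "\<lambda>i y. 0"] op_on_eqI])
      (use l_less in \<open>auto simp: Ft_col_def zero_op_op_on apply_seq_of intro!: bcontfun_eqI\<close>)
  ultimately show ?thesis
    unfolding F_block_def ext_dim_low scalar_op_op_on zero_op_op_on
    by (auto simp: block_op_op_on F_fun_def intro!: op_on_eqI seq_of_eqI)
qed

lemma equivalent_low:
  "equivalent_via {\<mu>} (power_space d \<times> UNIV) (power_space d \<times> UNIV)
    (power_space d \<times> UNIV) (power_space d \<times> UNIV)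
    (P_ext d l P X Q Z) (T_block d P X Q Z) (E_block d l P Q) (F_block d l P X)"
proof (rule equivalent_via_op_on[where T = "T_block d P X Q Z" and E = "E_block d l P Q"
      and F = "F_block d l P X" and gE = E_inv and gF = F_inv,
      OF _ T_block_eq E_block_eq F_block_eq T_fun_lin T_dom_subspace])
  \<comment> \<open>The one restricted component of \<open>F_fun v\<close> is
    \<open>\<mu> ^ l\<close> times component 0 of \<open>v\<close>, and \<open>\<mu> ^ l\<close> is
    nonzero.\<close>
  have scale: "\<mu> ^ l *\<^sub>C y \<in> Dp \<inter> Dq \<longleftrightarrow> y \<in> Dp \<inter> Dq" for y
    using subspaces(1,2) \<mu>_power by (simp add: subspace_scale_iff del: power_eq_0_iff)
  have "{v \<in> power_space (ext_dim d l) \<times> UNIV. apply_bcontfun (fst v) 0 \<in> Dp \<inter> Dq \<and> snd v \<in> Dx \<inter> Dz}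
      = {v \<in> power_space d \<times> UNIV. F_fun v \<in> T_dom}"
    using scale k_less
    by (auto simp: T_dom_def F_fun_def ext_dim_low apply_seq_of seq_of_in_power_space l_less d_simps)
  then show "P_ext d l P X Q Z \<mu> =
      op_on {v \<in> power_space d \<times> UNIV. F_fun v \<in> T_dom} (\<lambda>v. E_fun (T_fun (F_fun v)))"
    by (simp add: P_ext_eq P_ext_factorization[abs_def])
qed (simp_all add: bounded_transformations E_inv_E E_E_inv F_inv_F F_F_inv transformations_mem
    subspace_Times subspace_power_space T_fun_mem T_dom_subset image_subset_iff)

end

section \<open>The case of an unbounded leading coefficient\<close>

text \<open>\<open>c\<close> represents the bounded closure of the operator
  \<open>y \<mapsto> pinv (x y)\<close> on \<open>Dx\<close>. With it \<open>F\<close> is everywhere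
  defined although \<open>X\<close> need not be.\<close>

locale linearization_top = linearization +
  fixes c
  assumes l_eq: "l = d" and c_bdd: "bounded_clinear c"
    and closure_eq: "op_closure (op_inv (P d) \<circ>\<^sub>m X \<mu>) = op_on UNIV c"
    and c_eq: "\<And>y. y \<in> Dx \<Longrightarrow> c y = pinv (x y)"
begin

lemma \<mu>_nz: "\<mu> \<noteq> 0"
  using \<mu> l_eq d_pos by auto

lemma ext_dim_top: "ext_dim d l = Suc d"
  using l_eq by (simp add: ext_dim_def)

lemma p_bdd_top: "i < d \<Longrightarrow> bounded_clinear (p i)"
  using l_eq by (intro p_bdd) auto

lemma lower_p_bdd: "bounded_clinear (lower_coeff d \<mu> p j)"
  by (rule bounded_clinear_lower_coeff) (auto intro!: p_bdd_top)

lemma lower_q_bdd: "bounded_clinear (lower_coeff d \<mu> q j)"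
  by (rule bounded_clinear_lower_coeff) (auto intro!: q_bdd simp: l_eq)

lemmas bdd_intros = bounded_clinear_intros
  lower_p_bdd[THEN bounded_clinear_compose] lower_q_bdd[THEN bounded_clinear_compose]
  pinv_bdd[THEN bounded_clinear_compose] c_bdd[THEN bounded_clinear_compose]
  p_bdd_top[THEN bounded_clinear_compose]

text \<open>Here the corner \<open>\<mu>\<^sup>-\<^sup>d P(\<mu>) P\<^sub>d\<^sup>-\<^sup>1\<close> of \<open>E\<close> is written as \<open>I + B P\<^sub>d\<^sup>-\<^sup>1\<close> with \<open>B\<close> the first entry of
  \<open>E_beta\<close>: then \<open>E\<close> first adds \<open>P\<^sub>d\<^sup>-\<^sup>1\<close> of component 0 to component 1 and then the row
  \<open>E_beta\<close> of the result to component 0. In the same way the first row of \<open>F\<close> is expressed through the others.\<close>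

definition E_entry :: "(nat \<Rightarrow> 'a) \<Rightarrow> nat \<Rightarrow> 'a"
  where "E_entry u i = (if i = 1 then pinv (u 0) else 0) + u i"

definition E_fun :: "'a seq \<times> 'c \<Rightarrow> 'a seq \<times> 'c"
  where "E_fun v =
    (seq_of (Suc d) (\<lambda>i. if i = 0 then apply_bcontfun (fst v) 0
         + (\<Sum>j<d. lower_coeff d \<mu> p j (E_entry (apply_bcontfun (fst v)) (Suc j)))
       else E_entry (apply_bcontfun (fst v)) i),
     (\<Sum>j<d. lower_coeff d \<mu> q j (E_entry (apply_bcontfun (fst v)) (Suc j))) + snd v)"

text \<open>The lower components of the image are the vectors to which the row \<open>E_beta\<close>
  was applied, so subtracting that row recovers component 0: the Schur complement is the
  identity.\<close>

definition E_inv_head :: "(nat \<Rightarrow> 'a) \<Rightarrow> 'a"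
  where "E_inv_head t = t 0 - (\<Sum>j<d. lower_coeff d \<mu> p j (t (Suc j)))"

definition E_inv :: "'a seq \<times> 'c \<Rightarrow> 'a seq \<times> 'c"
  where "E_inv v =
    (seq_of (Suc d) (\<lambda>i. if i = 0 then E_inv_head (apply_bcontfun (fst v))
       else apply_bcontfun (fst v) i
         - (if i = 1 then pinv (E_inv_head (apply_bcontfun (fst v))) else 0)),
     snd v - (\<Sum>j<d. lower_coeff d \<mu> q j (apply_bcontfun (fst v) (Suc j))))"

definition F_entry :: "(nat \<Rightarrow> 'a) \<Rightarrow> nat \<Rightarrow> 'a"
  where "F_entry v i = \<mu> ^ (d - 1 - i) *\<^sub>C v 0 + v (Suc i)"

definition F_fun :: "'a seq \<times> 'b \<Rightarrow> 'a seq \<times> 'b"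
  where "F_fun v =
    (seq_of (Suc d) (\<lambda>i. if i = 0 then \<mu> ^ d *\<^sub>C apply_bcontfun (fst v) 0
         + (\<Sum>j<d. pinv (p (d - 1 - j) (F_entry (apply_bcontfun (fst v)) j))) + c (snd v)
       else F_entry (apply_bcontfun (fst v)) (i - 1)),
     snd v)"

text \<open>Once the contributions of the lower components and of \<open>c\<close> are removed, the
  Schur complement \<open>\<mu> ^ d\<close> remains to be divided out.\<close>

definition F_inv_head :: "'a seq \<times> 'b \<Rightarrow> 'a"
  where "F_inv_head v = (1 / \<mu> ^ d) *\<^sub>C (apply_bcontfun (fst v) 0
    - (\<Sum>j<d. pinv (p (d - 1 - j) (apply_bcontfun (fst v) (Suc j)))) - c (snd v))"

definition F_inv :: "'a seq \<times> 'b \<Rightarrow> 'a seq \<times> 'b"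
  where "F_inv v =
    (seq_of (Suc d) (\<lambda>i. if i = 0 then F_inv_head v
       else apply_bcontfun (fst v) i - \<mu> ^ (d - i) *\<^sub>C F_inv_head v),
     snd v)"

lemma bounded_transformations:
  "bounded_clinear E_fun" "bounded_clinear E_inv" "bounded_clinear F_fun" "bounded_clinear F_inv"
proof -
  show "bounded_clinear E_fun" unfolding E_fun_def E_entry_def
    by (intro bdd_intros)
  show "bounded_clinear E_inv" unfolding E_inv_def E_inv_head_def
    by (intro bdd_intros)
  show "bounded_clinear F_fun" unfolding F_fun_def F_entry_def
    by (intro bdd_intros) auto
  show "bounded_clinear F_inv" unfolding F_inv_def F_inv_head_def
    by (intro bdd_intros) auto
qed

lemma transformations_mem:
  "E_fun v \<in> power_space (Suc d) \<times> UNIV" "E_inv v \<in> power_space (Suc d) \<times> UNIV"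
  "F_fun w \<in> power_space (Suc d) \<times> UNIV" "F_inv w \<in> power_space (Suc d) \<times> UNIV"
  by (simp_all add: E_fun_def E_inv_def F_fun_def F_inv_def seq_of_in_power_space)

lemma E_inv_E:
  assumes "v \<in> power_space (Suc d) \<times> UNIV"
  shows "E_inv (E_fun v) = v"
proof -
  obtain u s where v: "v = (u, s)" by (cases v)
  have entry: "apply_bcontfun (fst (E_fun v)) (Suc j) = E_entry (apply_bcontfun u) (Suc j)" if "j < d" for j
    using that by (simp add: E_fun_def v apply_seq_of)
  have head: "E_inv_head (apply_bcontfun (fst (E_fun v))) = apply_bcontfun u 0"
    unfolding E_inv_head_def by (simp add: entry) (simp add: E_fun_def v apply_seq_of)
  have "snd (E_fun v) - (\<Sum>j<d. lower_coeff d \<mu> q j (apply_bcontfun (fst (E_fun v)) (Suc j))) = s"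
    by (simp add: entry) (simp add: E_fun_def v)
  moreover have "apply_bcontfun (fst (E_fun v)) i - (if i = 1 then pinv (apply_bcontfun u 0) else 0)
      = apply_bcontfun u i" if "i < Suc d" "i \<noteq> 0" for i
    using that entry[of "i - 1"] by (simp add: E_entry_def)
  ultimately have "E_inv (E_fun v) = (seq_of (Suc d) (apply_bcontfun u), s)"
    unfolding E_inv_def head by (auto intro!: seq_of_eqI)
  with assms show ?thesis by (simp add: v seq_of_apply)
qed

lemma E_E_inv:
  assumes "v \<in> power_space (Suc d) \<times> UNIV"
  shows "E_fun (E_inv v) = v"
proof -
  obtain t s where v: "v = (t, s)" by (cases v)
  have entry: "E_entry (apply_bcontfun (fst (E_inv v))) (Suc j) = apply_bcontfun t (Suc j)" if "j < d" for j
    using that by (simp add: E_inv_def v apply_seq_of E_entry_def)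
  have "E_fun (E_inv v) = (seq_of (Suc d) (apply_bcontfun t), s)"
    using entry[of "i - 1" for i] unfolding E_fun_def
    by (auto simp: entry gr0_conv_Suc intro!: seq_of_eqI) (auto simp: E_inv_def E_inv_head_def v apply_seq_of)
  with assms show ?thesis by (simp add: v seq_of_apply)
qed

lemma F_inv_F:
  assumes "v \<in> power_space (Suc d) \<times> UNIV"
  shows "F_inv (F_fun v) = v"
proof -
  obtain u y where v: "v = (u, y)" by (cases v)
  have head: "F_inv_head (F_fun v) = apply_bcontfun u 0"
    using \<mu>_nz by (simp add: F_inv_head_def F_fun_def v apply_seq_of)
  have "F_inv (F_fun v) = (seq_of (Suc d) (apply_bcontfun u), y)"
    unfolding F_inv_def head
    by (auto simp: F_fun_def F_entry_def v apply_seq_of gr0_conv_Suc intro!: seq_of_eqI)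
  with assms show ?thesis by (simp add: v seq_of_apply)
qed

lemma F_F_inv:
  assumes "v \<in> power_space (Suc d) \<times> UNIV"
  shows "F_fun (F_inv v) = v"
proof -
  obtain u y where v: "v = (u, y)" by (cases v)
  have entry: "F_entry (apply_bcontfun (fst (F_inv v))) i = apply_bcontfun u (Suc i)" if "i < d" for i
    using that by (simp add: F_entry_def F_inv_def v apply_seq_of)
  have "\<mu> ^ d *\<^sub>C apply_bcontfun (fst (F_inv v)) 0 = apply_bcontfun u 0
    - (\<Sum>j<d. pinv (p (d - 1 - j) (apply_bcontfun u (Suc j)))) - c y"
    using \<mu>_nz by (simp add: F_inv_def F_inv_head_def v apply_seq_of)
  then have "F_fun (F_inv v) = (seq_of (Suc d) (apply_bcontfun u), y)"
    unfolding F_fun_def by (auto simp: entry gr0_conv_Suc intro!: seq_of_eqI) (simp_all add: F_inv_def v)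
  with assms show ?thesis by (simp add: v seq_of_apply)
qed

section \<open>The direct sum with the leading coefficient\<close>

definition PT_fun :: "'a seq \<times> 'b \<Rightarrow> 'a seq \<times> 'c"
  where "PT_fun v = (let (u, s) = T_fun (seq_tl (fst v), snd v)
    in (seq_cons (p d (apply_bcontfun (fst v) 0)) u, s))"

definition PT_dom :: "('a seq \<times> 'b) set"
  where "PT_dom = {v \<in> power_space (Suc d) \<times> UNIV.
    apply_bcontfun (fst v) 0 \<in> Dp \<and> snd v \<in> Dx \<inter> Dz}"

lemma seq_tl_mem: "seq_tl v \<in> power_space m \<longleftrightarrow> v \<in> power_space (Suc m)"
proof -
  have "(\<forall>i\<ge>m. v (Suc i) = 0) \<longleftrightarrow> (\<forall>i\<ge>Suc m. v i = 0)"
    by (metis Suc_le_D Suc_le_mono)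
  then show ?thesis by (simp add: power_space_def apply_seq_tl)
qed

lemma PT_dsum_eq: "PT_dsum d P X Q Z \<mu> = op_on PT_dom PT_fun"
proof
  fix v :: "'a seq \<times> 'b"
  obtain a b where v: "v = (a, b)" by (cases v)
  \<comment> \<open>For \<open>l = d\<close> the linearization restricts the sequence only by its
    support.\<close>
  have T: "(seq_tl a, b) \<in> T_dom \<longleftrightarrow> a \<in> power_space (Suc d) \<and> b \<in> Dx \<inter> Dz"
    unfolding T_dom_def using l_eq by (simp add: seq_tl_mem)
  have Pd: "P d = op_on Dp (p d)"
    using P_eq[of d] l_eq by simp
  show "PT_dsum d P X Q Z \<mu> v = op_on PT_dom PT_fun v"
    unfolding PT_dsum_def T_block_eq Pd op_dsum_op_on v
    by (cases "T_fun (seq_tl a, b)") (auto simp: op_on_def PT_dom_def PT_fun_def T)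
qed

lemma PT_fun_mem: "PT_fun v \<in> power_space (Suc d) \<times> UNIV"
  using T_fun_mem[of "(seq_tl (fst v), snd v)"]
  by (auto simp: PT_fun_def Let_def case_prod_unfold power_space_def apply_seq_cons split: nat.splits)

lemma PT_fun_lin: "clinear PT_fun"
proof (rule clinearI)
  note T = clinear_simps[OF T_fun_lin]
  have tl_add: "seq_tl (u + v) = seq_tl u + seq_tl v" for u v :: "'a seq"
    by (rule bcontfun_eqI) (simp add: apply_seq_tl)
  have tl_scale: "seq_tl (a *\<^sub>C u) = a *\<^sub>C seq_tl u" for a and u :: "'a seq"
    by (rule bcontfun_eqI) (simp add: apply_seq_tl apply_scaleC_bcontfun)
  have cons_add: "seq_cons (a + b) (u + v) = seq_cons a u + seq_cons b v" for a b and u v :: "'a seq"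
    by (rule bcontfun_eqI) (simp add: apply_seq_cons split: nat.splits)
  have cons_scale: "seq_cons (a *\<^sub>C b) (a *\<^sub>C u) = a *\<^sub>C seq_cons b u" for a b and u :: "'a seq"
    by (rule bcontfun_eqI) (simp add: apply_seq_cons apply_scaleC_bcontfun split: nat.splits)
  show "PT_fun (v + w) = PT_fun v + PT_fun w" for v w
    using T(1)[of "(seq_tl (fst v), snd v)" "(seq_tl (fst w), snd w)"]
    by (simp add: PT_fun_def Let_def case_prod_unfold tl_add cons_add lin_simps)
  show "PT_fun (a *\<^sub>C v) = a *\<^sub>C PT_fun v" for a v
    using T(5)[of a "(seq_tl (fst v), snd v)"]
    by (simp add: PT_fun_def Let_def case_prod_unfold tl_scale cons_scale lin_simps scaleC_prod_def
        apply_scaleC_bcontfun)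
qed

lemma PT_dom_subspace: "complex_vs.subspace PT_dom"
  using subspaces subspace_power_space[of "Suc d"]
  by (auto simp: complex_vs.subspace_def PT_dom_def apply_scaleC_bcontfun scaleC_prod_def zero_prod_def)

text \<open>Apart from \<open>\<mu> ^ d\<close> times component 0, every summand lies in the range
  of \<open>pinv\<close> and so in \<open>Dp\<close>. For the value of \<open>c\<close> this holds
  because \<open>snd v\<close> is in \<open>Dx\<close>.\<close>

lemma Dp_iff: "apply_bcontfun (fst (F_fun v)) 0 \<in> Dp \<longleftrightarrow> apply_bcontfun (fst v) 0 \<in> Dp" if "snd v \<in> Dx" for v
proof -
  let ?r = "(\<Sum>j<d. pinv (p (d - 1 - j) (F_entry (apply_bcontfun (fst v)) j))) + c (snd v)"
  have r: "?r \<in> Dp"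
    using that by (intro complex_vs.subspace_add complex_vs.subspace_sum subspaces)
      (simp_all add: c_eq pinv_mem l_eq)
  have "apply_bcontfun (fst (F_fun v)) 0 = \<mu> ^ d *\<^sub>C apply_bcontfun (fst v) 0 + ?r"
    by (simp add: F_fun_def apply_seq_of)
  moreover have "a + ?r \<in> Dp \<longleftrightarrow> a \<in> Dp" for a
    using complex_vs.subspace_add[OF subspaces(1) _ r] complex_vs.subspace_diff[OF subspaces(1) _ r]
    by (metis add_diff_cancel_right')
  ultimately show ?thesis
    using \<mu>_nz subspaces(1) by (simp add: subspace_scale_iff)
qed

section \<open>The factorization for l = d\<close>

lemma P_ext_factorization:
  assumes "v \<in> power_space (Suc d) \<times> UNIV" "F_fun v \<in> PT_dom"
  shows "P_ext_fun v = E_fun (PT_fun (F_fun v))"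
proof -
  obtain u y where v: "v = (u, y)" by (cases v)
  define w where "w = apply_bcontfun (fst (F_fun v)) 0"
  define t where "t = F_entry (apply_bcontfun u)"
  \<comment> \<open>The lower components of \<open>F_fun v\<close>, preceded by
    \<open>\<mu> ^ d\<close> times component 0: the sequence needed in
    \<open>lower_row_identity\<close>.\<close>
  define \<omega> where "\<omega> = (\<lambda>j. case j of 0 \<Rightarrow> \<mu> ^ d *\<^sub>C apply_bcontfun u 0 | Suc j \<Rightarrow> t j)"
  have mem: "w \<in> Dp" "y \<in> Dx"
    using assms(2) by (auto simp: PT_dom_def w_def v F_fun_def)
  have w: "w = \<mu> ^ d *\<^sub>C apply_bcontfun u 0 + (\<Sum>j<d. pinv (p (d - 1 - j) (t j))) + pinv (x y)"
    using mem by (simp add: w_def t_def F_fun_def v apply_seq_of c_eq)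
  have tl: "apply_bcontfun (seq_tl (fst (F_fun v))) j = t j" if "j < d" for j
    using that by (simp add: apply_seq_tl F_fun_def v apply_seq_of t_def)
  have snd_F: "snd (F_fun v) = y" by (simp add: F_fun_def v)
  \<comment> \<open>At \<open>j = 0\<close> the transformation adds \<open>pinv (p d w) = w\<close>
    to the first component of \<open>T\<close>; the sums and \<open>pinv (x y)\<close> cancel, and a
    pure difference remains.\<close>
  have entry: "E_entry (apply_bcontfun (fst (PT_fun (F_fun v)))) (Suc j) = \<omega> j - \<mu> *\<^sub>C \<omega> (Suc j)"
    if "j < d" for j
    using that mem
    by (auto simp: E_entry_def PT_fun_def Let_def case_prod_unfold T_fun_def apply_seq_cons apply_seq_of
        tl snd_F \<omega>_def pinv_p w simp flip: w_def split: nat.splits)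
  have head: "apply_bcontfun (fst (PT_fun (F_fun v))) 0
      = \<mu> ^ d *\<^sub>C p d (apply_bcontfun u 0) + (\<Sum>j<d. p (d - 1 - j) (t j)) + x y"
    by (simp add: PT_fun_def Let_def case_prod_unfold apply_seq_cons lin_simps p_pinv w flip: w_def)
  have snd_PT: "snd (PT_fun (F_fun v)) = (\<Sum>j<d. q (d - 1 - j) (t j)) + z y"
    by (simp add: PT_fun_def Let_def case_prod_unfold T_fun_def tl snd_F)
  have row: "(\<Sum>j<d. lower_coeff d \<mu> r j (\<omega> j - \<mu> *\<^sub>C \<omega> (Suc j))) + (\<Sum>j<d. r (d - 1 - j) (t j))
      = (\<Sum>i<d. \<mu> ^ i *\<^sub>C r i (apply_bcontfun u 0))"
    if r: "\<And>i. clinear (r i)" for r :: "nat \<Rightarrow> 'a \<Rightarrow> 'e::complex_normed_vector"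
    using lower_row_identity[of r \<mu> d \<omega> "apply_bcontfun u 0", OF r] \<mu>_nz by (simp add: \<omega>_def)
  have P: "P_fun (apply_bcontfun u 0)
      = (\<Sum>i<d. \<mu> ^ i *\<^sub>C p i (apply_bcontfun u 0)) + \<mu> ^ d *\<^sub>C p d (apply_bcontfun u 0)"
    by (simp add: P_fun_def flip: lessThan_Suc_atMost)
  \<comment> \<open>The power of \<open>\<mu>\<close> in front of component 0 drops by one along
    \<open>\<omega>\<close>, so only the rows of \<open>N_l\<close> survive.\<close>
  have W: "\<omega> j - \<mu> *\<^sub>C \<omega> (Suc j) = W_fun (\<lambda>j. apply_bcontfun u (Suc j)) j" if "j < d" for j
  proof -
    have pow: "\<mu> ^ (d - j) = \<mu> * \<mu> ^ (d - 1 - j)"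
      using that by (metis Suc_diff_Suc diff_Suc_eq_diff_pred power_Suc)
    have W: "W_fun f j = (if 0 < j then f (j - 1) else 0) - \<mu> *\<^sub>C f j" for f j
      unfolding W_fun_def using l_eq by simp
    show ?thesis
    proof (cases j)
      case 0
      with pow show ?thesis
        by (simp add: \<omega>_def t_def F_entry_def W scaleC_add_right scaleC_scaleC)
    next
      case (Suc i)
      with pow show ?thesis
        by (simp add: \<omega>_def t_def F_entry_def W scaleC_add_right scaleC_scaleC)
    qed
  qed
  have "E_fun (PT_fun (F_fun v)) = (seq_of (Suc d) (\<lambda>i. if i = 0 then P_fun (apply_bcontfun u 0) + x y
      else W_fun (\<lambda>j. apply_bcontfun u (Suc j)) (i - 1)), Q_fun (apply_bcontfun u 0) + z y)"
    using row[of p, OF p_lin] row[of q, OF q_lin] unfolding E_fun_def head snd_PT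
    by (auto simp: entry P Q_fun_eq gr0_conv_Suc simp flip: W intro!: seq_of_eqI)
      (auto simp: algebra_simps)
  then show ?thesis by (simp add: P_ext_fun_def v ext_dim_top)
qed

section \<open>Identification with the block matrices for l = d\<close>

text \<open>Shows that the corners of \<open>E\<close> and \<open>Et\<close> contain the first
  entries of \<open>E_beta\<close> and \<open>Et_beta\<close>.\<close>

lemma lower_coeff_0_eq:
  assumes "\<And>i. clinear (r i)"
  shows "(1 / \<mu> ^ d) *\<^sub>C (\<Sum>i<d. \<mu> ^ i *\<^sub>C r i y) = lower_coeff d \<mu> r 0 y"
proof -
  have "(\<Sum>i<d. \<mu> ^ i *\<^sub>C r i y) = \<mu> ^ d *\<^sub>C lower_coeff d \<mu> r 0 y"
    using lower_coeff_0_power[of r \<mu> d y, OF assms \<mu>_nz]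
    by (simp add: clinear_simps[OF clinear_lower_coeff[OF assms]])
  then show ?thesis using \<mu>_nz by simp
qed

lemma sum_lower_coeff_E_entry:
  assumes r: "\<And>i. clinear (r i)"
  shows "(\<Sum>j<d. lower_coeff d \<mu> r j (E_entry u (Suc j)))
    = lower_coeff d \<mu> r 0 (pinv (u 0)) + (\<Sum>j<d. lower_coeff d \<mu> r j (u (Suc j)))"
proof -
  have "lower_coeff d \<mu> r j (E_entry u (Suc j))
      = (if j = 0 then lower_coeff d \<mu> r 0 (pinv (u 0)) else 0) + lower_coeff d \<mu> r j (u (Suc j))" for j
    by (simp add: E_entry_def clinear_simps[OF clinear_lower_coeff[OF r]])
  then show ?thesis using d_pos by (simp add: sum.distrib)
qed

lemma E_block_eq: "E_block d l P Q \<mu> = op_on (power_space (Suc d) \<times> UNIV) E_fun"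
proof -
  let ?e = "\<lambda>i j y. if i = 0 then (if j = 0 then y + lower_coeff d \<mu> p 0 (pinv y)
      else lower_coeff d \<mu> p (j - 1) y)
    else if j = 0 then (if i = 1 then pinv y else 0) else if i = j then y else 0"
  \<comment> \<open>The leading term, with \<open>P_d\<close> applied to its inverse, contributes
    the identity.\<close>
  have corner: "(1 / \<mu> ^ d) *\<^sub>C P_fun (pinv y) = y + lower_coeff d \<mu> p 0 (pinv y)" for y
    using \<mu>_nz lower_coeff_0_eq[of p "pinv y", OF p_lin]
    by (simp add: P_fun_def scaleC_add_right scaleC_scaleC p_pinv flip: lessThan_Suc_atMost)
  have E_corner: "(1 / \<mu> ^ d) *\<^sub>o (op_poly {..d} P \<mu> \<circ>\<^sub>m op_inv (P d))
      = op_on UNIV (\<lambda>y. y + lower_coeff d \<mu> p 0 (pinv y))"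
    unfolding op_poly_P pinv_eq map_comp_op_on op_scale_op_on corner
    using pinv_mem[OF l_eq] by simp
  have Et_corner: "(1 / \<mu> ^ d) *\<^sub>o (op_poly {..<d} Q \<mu> \<circ>\<^sub>m op_inv (P d))
      = op_on UNIV (\<lambda>y. lower_coeff d \<mu> q 0 (pinv y))"
    unfolding op_poly_Q pinv_eq map_comp_op_on op_scale_op_on Q_fun_eq lower_coeff_0_eq[OF q_lin]
    using Dq_UNIV[OF l_eq] by simp
  have beta: "E_beta d P \<mu> i j = op_on UNIV (if i = 0 then lower_coeff d \<mu> p j else (\<lambda>y. 0))" for i j
    using op_sum_lower_coeff[of d P p \<mu> j] l_eq by (simp add: E_beta_def P_eq zero_op_op_on)
  have Et_beta: "Et_beta d Q \<mu> j = op_on UNIV (lower_coeff d \<mu> q j)" for j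
    using op_sum_lower_coeff[of d Q q \<mu> j] l_eq by (simp add: Et_beta_def Q_eq)
  have E_entry: "E_mat d l P \<mu> i j = op_on UNIV (?e i j)" for i j
    unfolding E_mat_def using d_pos l_eq
    by (auto simp: four_blocks_def E_corner[unfolded pinv_eq] beta E_gamma_def pinv_eq id_mat_def scalar_op_op_on
        zero_op_op_on intro!: op_on_eqI)
  have Et_entry: "Et_row d l P Q \<mu> j
      = op_on UNIV (\<lambda>y. if j = 0 then lower_coeff d \<mu> q 0 (pinv y) else lower_coeff d \<mu> q (j - 1) y)" for j
    unfolding Et_row_def using d_pos l_eq by (auto simp: Et_corner Et_beta)
  have E_row: "(\<Sum>j<Suc d. ?e i j (u j)) = (if i = 0 then
      u 0 + (\<Sum>j<d. lower_coeff d \<mu> p j (E_entry u (Suc j))) else E_entry u i)" if "i < Suc d" for i u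
  proof (cases i)
    case 0
    then show ?thesis
      unfolding sum.lessThan_Suc_shift sum_lower_coeff_E_entry[OF p_lin] by (simp add: add.assoc)
  next
    case (Suc i')
    with that show ?thesis
      unfolding sum.lessThan_Suc_shift by (simp add: E_entry_def)
  qed
  have Et_row: "(\<Sum>j<Suc d. if j = 0 then lower_coeff d \<mu> q 0 (pinv (u j)) else lower_coeff d \<mu> q (j - 1) (u j))
      = (\<Sum>j<d. lower_coeff d \<mu> q j (E_entry u (Suc j)))" for u
    unfolding sum.lessThan_Suc_shift sum_lower_coeff_E_entry[OF q_lin] by simp
  have "mat_op (Suc d) (Suc d) (E_mat d l P \<mu>) = op_on (power_space (Suc d)) (\<lambda>v. fst (E_fun (v, 0)))"
    by (rule trans[OF mat_op_op_on op_on_eqI], rule E_entry)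
      (auto simp: E_fun_def E_row simp del: sum.lessThan_Suc intro!: seq_of_eqI)
  moreover have "row_op (Suc d) (Et_row d l P Q \<mu>) = op_on (power_space (Suc d)) (\<lambda>v. snd (E_fun (v, 0)))"
    by (rule trans[OF row_op_op_on op_on_eqI], rule Et_entry)
      (auto simp: E_fun_def Et_row simp del: sum.lessThan_Suc)
  ultimately show ?thesis
    unfolding E_block_def ext_dim_top scalar_op_op_on zero_op_op_on
    by (auto simp: block_op_op_on E_fun_def intro!: op_on_eqI seq_of_eqI)
qed

lemma F_block_eq: "F_block d l P X \<mu> = op_on (power_space (Suc d) \<times> UNIV) F_fun"
proof -
  let ?e = "\<lambda>i j y. if i = 0 then (if j = 0 then \<mu> ^ d *\<^sub>C y + (\<Sum>i<d. \<mu> ^ i *\<^sub>C pinv (p i y))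
      else pinv (p (d - 1 - (j - 1)) y))
    else if j = 0 then \<mu> ^ (d - 1 - (i - 1)) *\<^sub>C y else if i = j then y else 0"
  have poly: "op_poly {..<d} (P_hat d P) \<mu> = op_on UNIV (\<lambda>y. \<Sum>i<d. \<mu> ^ i *\<^sub>C pinv (p i y))"
    unfolding op_poly_def by (rule trans[OF op_sum_op_on op_on_eqI])
      (use l_eq in \<open>auto simp: P_hat_eq op_scale_op_on\<close>)
  have entry: "F_mat d l P \<mu> i j = op_on UNIV (?e i j)" for i j
    unfolding F_mat_def using d_pos l_eq
    by (auto simp: four_blocks_def poly P_hat_eq F_gamma_def F_beta_def op_plus_op_on id_mat_def
        scalar_op_op_on zero_op_op_on intro!: op_on_eqI)
  have row: "(\<Sum>j<Suc d. ?e i j (u j)) = (if i = 0 then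
      \<mu> ^ d *\<^sub>C u 0 + (\<Sum>j<d. pinv (p (d - 1 - j) (F_entry u j))) else F_entry u (i - 1))"
    if "i < Suc d" for i u
  proof (cases i)
    case 0
    \<comment> \<open>Reversing the order of summation aligns the powers in the corner with those of
      \<open>F_beta\<close>.\<close>
    have "(\<Sum>i<d. \<mu> ^ i *\<^sub>C pinv (p i (u 0)))
        = (\<Sum>j<d. \<mu> ^ (d - 1 - j) *\<^sub>C pinv (p (d - 1 - j) (u 0)))"
      using sum.nat_diff_reindex[of "\<lambda>i. \<mu> ^ i *\<^sub>C pinv (p i (u 0))" d] by simp
    with 0 show ?thesis
      unfolding sum.lessThan_Suc_shift by (simp add: F_entry_def lin_simps sum.distrib add.assoc)
  next
    case (Suc i')
    with that show ?thesis
      unfolding sum.lessThan_Suc_shift by (simp add: F_entry_def)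
  qed
  have "mat_op (Suc d) (Suc d) (F_mat d l P \<mu>) = op_on (power_space (Suc d)) (\<lambda>v. fst (F_fun (v, 0)))"
    by (rule trans[OF mat_op_op_on op_on_eqI], rule entry)
      (auto simp: F_fun_def row clinear_simps[OF bounded_clinear_clinear[OF c_bdd]]
        simp del: sum.lessThan_Suc intro!: seq_of_eqI)
  moreover have "col_op (Suc d) (Ft_col d l P X \<mu>)
      = op_on UNIV (\<lambda>y. seq_of (Suc d) (\<lambda>i. if i = 0 then c y else 0))"
    by (rule trans[OF col_op_op_on[of _ _ "\<lambda>i. UNIV" "\<lambda>i y. if i = 0 then c y else 0"] op_on_eqI])
      (use l_eq in \<open>auto simp: Ft_col_def closure_eq zero_op_op_on\<close>)
  ultimately show ?thesis
    unfolding F_block_def ext_dim_top scalar_op_op_on zero_op_op_on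
    by (auto simp: block_op_op_on F_fun_def seq_of_add clinear_simps[OF bounded_clinear_clinear[OF c_bdd]]
        intro!: op_on_eqI seq_of_eqI)
qed

lemma equivalent_top:
  "equivalent_via {\<mu>} (power_space (Suc d) \<times> UNIV) (power_space (Suc d) \<times> UNIV)
    (power_space (Suc d) \<times> UNIV) (power_space (Suc d) \<times> UNIV)
    (P_ext d l P X Q Z) (PT_dsum d P X Q Z) (E_block d l P Q) (F_block d l P X)"
proof (rule equivalent_via_op_on[where T = "PT_dsum d P X Q Z" and E = "E_block d l P Q"
      and F = "F_block d l P X" and gE = E_inv and gF = F_inv,
      OF _ PT_dsum_eq E_block_eq F_block_eq PT_fun_lin PT_dom_subspace])
  have dom: "{v \<in> power_space (ext_dim d l) \<times> UNIV. apply_bcontfun (fst v) 0 \<in> Dp \<inter> Dq \<and> snd v \<in> Dx \<inter> Dz}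
      = {v \<in> power_space (Suc d) \<times> UNIV. F_fun v \<in> PT_dom}"
    using Dq_UNIV[OF l_eq] transformations_mem(3) Dp_iff
    by (auto simp: PT_dom_def ext_dim_top) (auto simp: F_fun_def)
  show "P_ext d l P X Q Z \<mu> =
      op_on {v \<in> power_space (Suc d) \<times> UNIV. F_fun v \<in> PT_dom} (\<lambda>v. E_fun (PT_fun (F_fun v)))"
    unfolding P_ext_eq dom using P_ext_factorization by (intro op_on_eqI) auto
  show "PT_dom \<subseteq> power_space (Suc d) \<times> UNIV" by (auto simp: PT_dom_def)
qed (simp_all add: bounded_transformations E_inv_E E_E_inv F_inv_F F_F_inv transformations_mem
    subspace_Times subspace_power_space PT_fun_mem image_subset_iff)

end

section \<open>Passage to all points of the parameter set\<close>

lemma equivalent_onI: "equivalent_via \<Omega> U U' V V' S T E F \<Longrightarrow> equivalent_on \<Omega> U U' V V' S T"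
  by (auto simp: equivalent_on_def)

text \<open>Allows the linear extensions of \<open>X \<mu>\<close> and \<open>Z \<mu>\<close>, and
  the map \<open>c\<close>, to be chosen anew at each point.\<close>

lemma equivalent_via_pointwise:
  "equivalent_via \<Omega> U U' V V' S T E F \<longleftrightarrow> (\<forall>\<mu>\<in>\<Omega>. equivalent_via {\<mu>} U U' V V' S T E F)"
  by (simp add: equivalent_via_def)

theorem theorem3p11:
  fixes d l :: nat
    and P :: "nat \<Rightarrow> 'h::complex_banach \<rightharpoonup> 'h"
    and X :: "complex \<Rightarrow> 'k::complex_banach \<rightharpoonup> 'h"
    and Q :: "nat \<Rightarrow> 'h \<rightharpoonup> 'm::complex_banach"
    and Z :: "complex \<Rightarrow> 'k \<rightharpoonup> 'm"
    and \<Omega> :: "complex set"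
  assumes "d \<ge> 1" and "l \<le> d"
    and "P l \<in> lin_ops UNIV UNIV"
    and "\<And>i. i \<le> d \<Longrightarrow> i \<noteq> l \<Longrightarrow> P i \<in> bdd_ops UNIV UNIV"
    and "invertible_op UNIV UNIV (P d)"
    and "\<Omega> \<subseteq> (if l = 0 then UNIV else UNIV - {0})"
    and "\<And>\<mu>. \<mu> \<in> \<Omega> \<Longrightarrow> X \<mu> \<in> lin_ops UNIV UNIV"
    and "\<And>\<mu>. \<mu> \<in> \<Omega> \<Longrightarrow> Z \<mu> \<in> lin_ops UNIV UNIV"
    and "\<And>i. i < d \<Longrightarrow> Q i \<in> lin_ops UNIV UNIV"
    and "\<And>i. i < d \<Longrightarrow> i \<noteq> l \<Longrightarrow> Q i \<in> bdd_ops UNIV UNIV"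
    and "\<And>\<mu>. l = d \<Longrightarrow> \<mu> \<in> \<Omega> \<Longrightarrow> op_closure (op_inv (P d) \<circ>\<^sub>m X \<mu>) \<in> bdd_ops UNIV UNIV"
  shows
    "(l < d \<longrightarrow> equivalent_on \<Omega>
        (power_space (ext_dim d l) \<times> UNIV) (power_space (ext_dim d l) \<times> UNIV)
        (power_space d \<times> UNIV) (power_space d \<times> UNIV)
        (P_ext d l P X Q Z) (T_block d P X Q Z)) \<and>
     (l = d \<longrightarrow> equivalent_on \<Omega>
        (power_space (ext_dim d l) \<times> UNIV) (power_space (ext_dim d l) \<times> UNIV)
        (power_space (d + 1) \<times> UNIV) (power_space (d + 1) \<times> UNIV)
        (P_ext d l P X Q Z) (PT_dsum d P X Q Z)) \<and>
     equivalent_via \<Omega>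
        (power_space (ext_dim d l) \<times> UNIV) (power_space (ext_dim d l) \<times> UNIV)
        (power_space (ext_dim d l) \<times> UNIV) (power_space (ext_dim d l) \<times> UNIV)
        (P_ext d l P X Q Z) (T_star d l P X Q Z) (E_block d l P Q) (F_block d l P X) \<and>
     (\<forall>\<mu>\<in>\<Omega>. \<forall>v\<in>power_space (ext_dim d l) \<times> UNIV.
        map_option reorder (P_ext d l P X Q Z \<mu> v) =
        op_dsum (P_block d P X Q Z \<mu>) (W_op d l \<mu>) (reorder v))"
proof -
  note hP = assms(4) and hQ = assms(10)
  have "\<exists>f. clinear f \<and> (i \<le> d \<longrightarrow> P i = op_on (if i = l then dom (P l) else UNIV) f \<and>
      (i \<noteq> l \<longrightarrow> bounded_clinear f))" for i
  proof -
    consider "d < i" | "i = l" | "i \<le> d" "i \<noteq> l" by linarith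
    then show ?thesis
    proof cases
      case 1
      then show ?thesis by (auto intro!: exI[of _ "\<lambda>y. 0"] clinearI)
    next
      case 2
      then show ?thesis using lin_opsE[OF assms(3)] by auto
    next
      case 3
      then show ?thesis using bdd_ops_UNIV_E[OF hP[OF 3]] by (metis bounded_clinear_clinear)
    qed
  qed
  then obtain p where p_lin: "\<And>i. clinear (p i)"
    and p_eq: "\<And>i. i \<le> d \<Longrightarrow> P i = op_on (if i = l then dom (P l) else UNIV) (p i)"
    and p_bdd: "\<And>i. i \<le> d \<Longrightarrow> i \<noteq> l \<Longrightarrow> bounded_clinear (p i)"
    by metis
  \<comment> \<open>For \<open>l = d\<close> there is no coefficient \<open>Q l\<close>, and the
    whole space serves as default.\<close>
  define Dq where "Dq = (if l < d then dom (Q l) else UNIV)"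
  have "\<exists>f. clinear f \<and> (i < d \<longrightarrow> Q i = op_on (if i = l then Dq else UNIV) f) \<and>
      (i \<noteq> l \<longrightarrow> bounded_clinear f) \<and> (d \<le> i \<longrightarrow> f = (\<lambda>y. 0))" for i
  proof -
    consider "d \<le> i" | "i = l" "l < d" | "i < d" "i \<noteq> l" by linarith
    then show ?thesis
    proof cases
      case 1
      then show ?thesis by (auto intro!: exI[of _ "\<lambda>y. 0"] clinearI bounded_clinear_zero)
    next
      case 2
      then show ?thesis using lin_opsE[OF assms(9)[OF 2(2)]] by (auto simp: Dq_def)
    next
      case 3
      then show ?thesis using bdd_ops_UNIV_E[OF hQ[OF 3]] by (metis bounded_clinear_clinear leD)
    qed
  qed
  then obtain q where q_lin: "\<And>i. clinear (q i)"
    and q_eq: "\<And>i. i < d \<Longrightarrow> Q i = op_on (if i = l then Dq else UNIV) (q i)"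
    and q_bdd: "\<And>i. i \<noteq> l \<Longrightarrow> bounded_clinear (q i)"
    and q_zero: "\<And>i. d \<le> i \<Longrightarrow> q i = (\<lambda>y. 0)"
    by metis
  have inv: "inj_on (P d) (dom (P d))" "ran (P d) = UNIV" "op_inv (P d) \<in> bdd_ops UNIV UNIV"
    using assms(5) by (simp_all add: invertible_op_def)
  obtain pinv where pinv: "bounded_clinear pinv" "op_inv (P d) = op_on UNIV pinv"
    using bdd_ops_UNIV_E[OF inv(3)] by blast
  \<comment> \<open>In this partial form the equation also states that \<open>pinv\<close> maps into
    the domain of \<open>P d\<close>, a proper restriction being possible only for
    \<open>l = d\<close>.\<close>
  have pinv_Some: "P d (pinv y) = Some y" for y
  proof -
    obtain v where v: "P d v = Some y" using inv(2) by (auto simp: ran_def)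
    then have "(THE v. P d v = Some y) = v"
      using inj_onD[OF inv(1)] by (intro the_equality) (auto simp: domI)
    then have "op_inv (P d) y = Some v" using inv(2) by (simp add: op_inv_def)
    then show ?thesis using v pinv(2) by (simp add: op_on_def)
  qed
  have Pd: "P d v = (if l = d \<longrightarrow> v \<in> dom (P l) then Some (p d v) else None)" for v
    by (subst p_eq[OF order_refl]) (auto simp: op_on_def)
  have p_pinv: "p d (pinv y) = y" for y
    using Pd[of "pinv y"] unfolding pinv_Some by (metis option.distinct(1) option.inject)
  have pinv_mem: "pinv y \<in> dom (P l)" if "l = d" for y
    using that pinv_Some[of y] by auto
  have pinv_p: "pinv (p d v) = v" if "l = d \<longrightarrow> v \<in> dom (P l)" for v
  proof -
    have "P d v = Some (p d v)" using that Pd[of v] by simp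
    then show ?thesis
      using pinv_Some[of "p d v"] inv(1) by (metis domI inj_onD)
  qed
  let ?U = "power_space (ext_dim d l) \<times> UNIV"
  have main: "equivalent_via {\<mu>} (?U :: ('h seq \<times> 'k) set) (?U :: ('h seq \<times> 'm) set) ?U ?U
        (P_ext d l P X Q Z) (T_star d l P X Q Z) (E_block d l P Q) (F_block d l P X) \<and>
      (\<forall>v\<in>?U. map_option reorder (P_ext d l P X Q Z \<mu> v) =
        op_dsum (P_block d P X Q Z \<mu>) (W_op d l \<mu>) (reorder v))" if mem: "\<mu> \<in> \<Omega>" for \<mu>
  proof -
    obtain x where x: "clinear x" "complex_vs.subspace (dom (X \<mu>))" "X \<mu> = op_on (dom (X \<mu>)) x"
      using lin_opsE[OF assms(7)[OF mem]] by blast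
    obtain z where z: "clinear z" "complex_vs.subspace (dom (Z \<mu>))" "Z \<mu> = op_on (dom (Z \<mu>)) z"
      using lin_opsE[OF assms(8)[OF mem]] by blast
    have lin: "linearization d l \<mu> P X Q Z p x q z pinv (dom (P l)) Dq (dom (X \<mu>)) (dom (Z \<mu>))"
    proof (rule linearization.intro)
      show "\<mu> \<noteq> 0 \<or> l = 0" using assms(6) mem by (auto split: if_splits)
      show "complex_vs.subspace (dom (P l))" using lin_opsE[OF assms(3)] by blast
      show "complex_vs.subspace Dq"
        using lin_opsE[OF assms(9)[of l]] by (auto simp: Dq_def)
      show "q i y = 0" if "d \<le> i" for i y using that by (simp add: q_zero)
      show "Dq = UNIV" if "l = d" using that by (simp add: Dq_def)
    qed (rule assms(1,2) p_lin p_eq p_bdd q_lin q_eq q_bdd pinv p_pinv pinv_mem pinv_p x z;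
        assumption?)+
    then interpret linearization d l \<mu> P X Q Z p x q z pinv "dom (P l)" Dq "dom (X \<mu>)" "dom (Z \<mu>)" .
    have "equivalent_via {\<mu>} (?U :: ('h seq \<times> 'k) set) (?U :: ('h seq \<times> 'm) set) ?U ?U
        (P_ext d l P X Q Z) (T_star d l P X Q Z) (E_block d l P Q) (F_block d l P X)"
    proof (cases "l < d")
      case True
      then interpret linearization_low d l \<mu> P X Q Z p x q z pinv "dom (P l)" Dq "dom (X \<mu>)"
        "dom (Z \<mu>)" "d - 1 - l"
        by unfold_locales simp
      show ?thesis
        using True equivalent_low unfolding T_star_def ext_dim_low by simp
    next
      case False
      then have l: "l = d" using assms(2) by simp
      obtain c where c: "bounded_clinear c" "op_closure (op_inv (P d) \<circ>\<^sub>m X \<mu>) = op_on UNIV c"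
        using bdd_ops_UNIV_E[OF assms(11)[OF l mem]] by blast
      \<comment> \<open>The closure extends the operator, so \<open>c\<close> has its values on the
        domain of \<open>X \<mu>\<close>.\<close>
      have "c y = pinv (x y)" if "y \<in> dom (X \<mu>)" for y
      proof -
        have "(op_inv (P d) \<circ>\<^sub>m X \<mu>) y = Some (pinv (x y))"
          using that fun_cong[OF x(3), of y] by (simp add: pinv(2) op_on_def map_comp_def)
        from op_closure_eq[OF assms(11)[OF l mem] this] show ?thesis
          by (simp add: c(2) op_on_def)
      qed
      with l c interpret linearization_top d l \<mu> P X Q Z p x q z pinv "dom (P l)" Dq "dom (X \<mu>)"
        "dom (Z \<mu>)" c
        by unfold_locales
      show ?thesis
        using False equivalent_top unfolding T_star_def ext_dim_top by simp
    qed
    then show ?thesis using reorder_P_ext by blast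
  qed
  then have via: "equivalent_via \<Omega> (?U :: ('h seq \<times> 'k) set) (?U :: ('h seq \<times> 'm) set) ?U ?U
      (P_ext d l P X Q Z) (T_star d l P X Q Z) (E_block d l P Q) (F_block d l P X)"
    by (subst equivalent_via_pointwise) blast
  moreover note equivalent_onI[OF via]
  moreover have "ext_dim d l = d" if "l < d" using that by (simp add: ext_dim_def)
  moreover have "ext_dim d l = d + 1" if "l = d" using that by (simp add: ext_dim_def)
  ultimately show ?thesis
    using main by (auto simp: T_star_def)
qed

end
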